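(* Let $\{t_n\}_{n=0}^\infty\subset[0,1]$. The following two statements are equivalent: (i) $\{t_n\}$ satisfies condition (T): for every sequence $\{a_\nu\}_{\nu\ge 1}\in\ell_2$ with $a_\nu\ge 0$ for all $\nu$, $$\liminf_{m\to\infty}\frac{a_m}{t_m}\sum_{\nu=1}^m a_\nu=0.$$ (ii) For every real Hilbert space $H$, every family $\{C_\alpha\}_{\alpha\in\Omega}$ ($|\Omega|\ge 2$) of closed convex subsets of $H$ which is uniformly quasi-symmetric with respect to some point $a\in C=\bigcap_{\alpha\in\Omega}C_\alpha$, and every starting element $x_0\in H$, every sequence $\{x_n\}$ of remote projections onto $\{C_\alpha\}$ with weakness parameters $\{t_n\}$ starting at $x_0$ converges in norm to a point of $C$.
   Context: $H$ denotes a real Hilbert space with inner product $\langle\cdot,\cdot\rangle$ and norm $|\cdot|$; $P_\alpha$ denotes the metric (nearest point) projection onto the closed convex set $C_\alpha$, and $B(0,r)$ the closed ball of radius $r$ centered at $0$. Remote projections: given a family $\{C_\alpha\}_{\alpha\in\Omega}$ of closed convex sets with nonempty intersection, weakness parameters $t_n\in[0,1]$ and $x_0\in H$, a sequence of remote projections is defined by $x_{n+1}=P_{\alpha(n)}x_n$ ($n=0,1,2,\dots$), where $\alpha(n)\in\Omega$ is any index with $\mathrm{dist}(x_n,C_{\alpha(n)})\ge t_n\sup_{\alpha\in\Omega}\mathrm{dist}(x_n,C_\alpha)$; if $t_n=1$ for at least one $n$, it is additionally required that $\max_\alpha\mathrm{dist}(x,C_\alpha)$ is attained for every $x\in H$.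 A family $\{C_\alpha\}$ of closed convex sets all containing $0$ is uniformly quasi-symmetric if for every $r>0$ there is $\theta=\theta(r)\in(0,1]$ such that for all $\alpha$, $x\in C_\alpha\cap B(0,r)$ implies $-\theta x\in C_\alpha$. The family is uniformly quasi-symmetric with respect to a point $a\in\bigcap_\alpha C_\alpha$ if the family $\{C_\alpha-a\}$ is uniformly quasi-symmetric. *)

theory Defs
  imports "HOL-Analysis.Analysis"
begin

text \<open>Metric (nearest point) projection onto a set C (well defined for nonempty
  closed convex subsets of a real Hilbert space).\<close>
definition metric_proj :: "'a::real_inner set \<Rightarrow> 'a \<Rightarrow> 'a" where
  "metric_proj C x = (THE y. y \<in> C \<and> (\<forall>z\<in>C. norm (x - y) \<le> norm (x - z)))"

text \<open>Condition (T) on the weakness sequence; sequences are indexed from 1, and the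
  quotient a_m / t_m is taken in the extended reals (a/0 = infinity for a > 0, 0/0 = 0).\<close>
definition condition_T :: "(nat \<Rightarrow> real) \<Rightarrow> bool" where
  "condition_T t \<longleftrightarrow>
     (\<forall>a :: nat \<Rightarrow> real. (\<forall>\<nu>\<ge>1. 0 \<le> a \<nu>) \<and> summable (\<lambda>\<nu>. (a \<nu>)\<^sup>2) \<longrightarrow>
        liminf (\<lambda>m. ereal (a m) / ereal (t m) * ereal (\<Sum>\<nu>=1..m. a \<nu>)) = 0)"

definition unif_quasi_symmetric :: "'i set \<Rightarrow> ('i \<Rightarrow> 'a::real_normed_vector set) \<Rightarrow> bool" where
  "unif_quasi_symmetric \<Omega> C \<longleftrightarrow>
     (\<forall>\<alpha>\<in>\<Omega>. 0 \<in> C \<alpha>) \<and>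
     (\<forall>r>0. \<exists>\<theta>. 0 < \<theta> \<and> \<theta> \<le> 1 \<and>
        (\<forall>\<alpha>\<in>\<Omega>. \<forall>x. x \<in> C \<alpha> \<and> norm x \<le> r \<longrightarrow> - (\<theta> *\<^sub>R x) \<in> C \<alpha>))"

definition unif_quasi_symmetric_wrt ::
    "'i set \<Rightarrow> ('i \<Rightarrow> 'a::real_normed_vector set) \<Rightarrow> 'a \<Rightarrow> bool" where
  "unif_quasi_symmetric_wrt \<Omega> C a \<longleftrightarrow>
     a \<in> (\<Inter>\<alpha>\<in>\<Omega>. C \<alpha>) \<and> unif_quasi_symmetric \<Omega> (\<lambda>\<alpha>. (\<lambda>y. y - a) ` C \<alpha>)"

definition remote_projections ::
    "'i set \<Rightarrow> ('i \<Rightarrow> 'a::real_inner set) \<Rightarrow> (nat \<Rightarrow> real) \<Rightarrow> 'a \<Rightarrow> (nat \<Rightarrow> 'a) \<Rightarrow> bool" where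
  "remote_projections \<Omega> C t x0 x \<longleftrightarrow>
     x 0 = x0 \<and>
     ((\<exists>n. t n = 1) \<longrightarrow>
        (\<forall>y. \<exists>\<alpha>\<in>\<Omega>. infdist y (C \<alpha>) = (SUP \<beta>\<in>\<Omega>. infdist y (C \<beta>)))) \<and>
     (\<forall>n. \<exists>\<alpha>\<in>\<Omega>. infdist (x n) (C \<alpha>) \<ge> t n * (SUP \<beta>\<in>\<Omega>. infdist (x n) (C \<beta>)) \<and>
                  x (Suc n) = metric_proj (C \<alpha>) (x n))"

text \<open>Statement (ii) restricted to a given space type 'a and index type 'i.\<close>
definition remote_projections_converge ::
    "(nat \<Rightarrow> real) \<Rightarrow> 'a::{real_inner,complete_space} itself \<Rightarrow> 'i itself \<Rightarrow> bool" where
  "remote_projections_converge t _ _ \<longleftrightarrow>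
     (\<forall>(\<Omega>::'i set) (C::'i \<Rightarrow> 'a set) a x0 x.
        (\<exists>\<alpha>\<in>\<Omega>. \<exists>\<beta>\<in>\<Omega>. \<alpha> \<noteq> \<beta>) \<and>
        (\<forall>\<alpha>\<in>\<Omega>. closed (C \<alpha>) \<and> convex (C \<alpha>)) \<and>
        unif_quasi_symmetric_wrt \<Omega> C a \<and>
        remote_projections \<Omega> C t x0 x
        \<longrightarrow> (\<exists>z \<in> (\<Inter>\<alpha>\<in>\<Omega>. C \<alpha>). x \<longlonglongrightarrow> z))"

definition infinite_dimensional :: "'a::real_vector itself \<Rightarrow> bool" where
  "infinite_dimensional _ \<longleftrightarrow> \<not> (\<exists>B::'a set. finite B \<and> span B = UNIV)"

end

theory Submission
  imports Defs
begin

text \<open>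
  Sufficiency. Put \<open>d\<^sub>k = |x\<^sub>k - x\<^sub>k\<^sub>+\<^sub>1|\<close>; the distances to a point of the intersection decrease and
  \<open>d\<close> is square summable. Quasi-symmetry turns the variational inequality of the projections into
  \<open>|x\<^sub>n - x\<^sub>m|\<^sup>2 \<le> (1 + 1/\<theta>) (|x\<^sub>n - a|\<^sup>2 - |x\<^sub>m - a|\<^sup>2) + 2 (d\<^sub>m/t\<^sub>m) (d\<^sub>n + \<dots> + d\<^sub>m)\<close>,
  and condition (T) makes the last term small for infinitely many \<open>m\<close>.

  Necessity. If (T) fails, there are positive weights \<open>b \<in> \<ell>\<^sub>2\<close> with divergent partial sums \<open>\<sigma>\<^sub>n\<close> and
  \<open>b\<^sub>n (q + \<sigma>\<^sub>n) \<ge> 24 t\<^sub>n\<close> for all \<open>n\<close>. Project onto hyperplanes orthogonal to \<open>\<tau> e\<^sub>p - e\<^sub>L\<close> with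
  \<open>0 \<le> \<tau> \<le> 1/2\<close>, so that the largest coordinate \<open>M\<^sub>n\<close> of \<open>x\<^sub>n \<ge> 0\<close> is gradually split into two. A step of
  size about \<open>b\<^sub>n\<close> costs \<open>O(b\<^sub>n\<^sup>2)\<close> of the squared norm and increases the \<open>\<ell>\<^sub>1\<close>-norm \<open>S\<^sub>n\<close> of the
  coordinates by about \<open>b\<^sub>n\<close>. As the coordinates stay comparable, \<open>M\<^sub>n S\<^sub>n\<close> is bounded, hence
  \<open>M\<^sub>n = O(1/(q + \<sigma>\<^sub>n))\<close> and the step \<open>b\<^sub>n\<close> exceeds \<open>t\<^sub>n M\<^sub>n\<close>, while \<open>M\<^sub>n\<close> bounds all distances because
  the two coefficients have opposite signs. When \<open>b\<^sub>n\<close> is not small against \<open>M\<^sub>n\<close>, the largest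
  coordinate is simply deleted. The norm of \<open>x\<^sub>n\<close> stays away from zero, although only \<open>0\<close> could be a
  limit in the intersection.
\<close>

section \<open>Sequences\<close>

lemma summable_power2_add:
  fixes f g :: "nat \<Rightarrow> real"
  assumes "summable (\<lambda>n. (f n)\<^sup>2)" "summable (\<lambda>n. (g n)\<^sup>2)"
  shows "summable (\<lambda>n. (f n + g n)\<^sup>2)"
proof (rule summable_comparison_test)
  show "summable (\<lambda>n. 2 * (f n)\<^sup>2 + 2 * (g n)\<^sup>2)" by (intro summable_add summable_mult assms)
  have "(f n + g n)\<^sup>2 \<le> 2 * (f n)\<^sup>2 + 2 * (g n)\<^sup>2" for n
    using sum_squares_bound[of "f n" "g n"] by (simp add: power2_sum)
  then show "\<exists>N. \<forall>n\<ge>N. norm ((f n + g n)\<^sup>2) \<le> 2 * (f n)\<^sup>2 + 2 * (g n)\<^sup>2" by simp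
qed

lemma summable_power2_inverse_Suc: "summable (\<lambda>n. (inverse (real (Suc n)))\<^sup>2)"
  using inverse_power_summable[of 2, where 'a = real]
  unfolding summable_Suc_iff[where f = "\<lambda>n. (inverse (real n))\<^sup>2"] by (simp add: power_inverse)

lemma filterlim_sum_at_top_if_ge_inverse_Suc:
  fixes b :: "nat \<Rightarrow> real"
  assumes "\<And>n. inverse (real (Suc n)) \<le> b n"
  shows "filterlim (\<lambda>n. \<Sum>k<n. b k) at_top sequentially"
proof (rule filterlim_at_top_mono[OF harm_at_top always_eventually], rule allI)
  show "harm n \<le> (\<Sum>k<n. b k)" for n unfolding harm_altdef by (intro sum_mono assms)
qed

lemma sum_le_if_eq_from:
  fixes f g :: "nat \<Rightarrow> real"
  assumes "\<And>n. 0 \<le> g n" "\<And>n. 0 \<le> f n" "\<And>n. N \<le> n \<Longrightarrow> g n = f n"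
  shows "(\<Sum>k<n. f k) \<le> (\<Sum>k<N. f k) + (\<Sum>k<n. g k)"
proof -
  have "(\<Sum>k<n. f k) \<le> (\<Sum>k<n. (if k \<in> {..<N} then f k else 0) + g k)"
    using assms by (intro sum_mono) (auto simp: not_less)
  also have "\<dots> = (\<Sum>k\<in>{..<n} \<inter> {..<N}. f k) + (\<Sum>k<n. g k)"
    by (simp only: sum.distrib sum.inter_restrict[OF finite_lessThan])
  also have "(\<Sum>k\<in>{..<n} \<inter> {..<N}. f k) \<le> (\<Sum>k<N. f k)"
    using assms(2) by (intro sum_mono2) auto
  finally show ?thesis by simp
qed

lemma summable_power2_modify_initial:
  fixes b0 :: "nat \<Rightarrow> real"
  assumes "\<And>n. 0 < b0 n" "summable (\<lambda>n. (b0 n)\<^sup>2)" "0 < \<epsilon>"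
  obtains b :: "nat \<Rightarrow> real" and N where "n0 \<le> N" "\<And>n. N \<le> n \<Longrightarrow> b n = b0 n"
    "\<And>n. 0 < b n" "\<And>n. (\<Sum>k<n. (b k)\<^sup>2) \<le> \<epsilon>"
proof -
  obtain N0 where N0: "\<And>m n. N0 \<le> m \<Longrightarrow> norm (\<Sum>k=m..<n. (b0 k)\<^sup>2) < \<epsilon> / 2"
    using assms(2) \<open>0 < \<epsilon>\<close> unfolding summable_Cauchy by (metis half_gt_zero)
  define N where "N = max n0 N0"
  define \<beta> where "\<beta> = sqrt (\<epsilon> / (2 * real (Suc N)))"
  have \<beta>: "0 < \<beta>" "real N * \<beta>\<^sup>2 \<le> \<epsilon> / 2"
    unfolding \<beta>_def using \<open>0 < \<epsilon>\<close> by (simp_all add: field_simps)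
  define b where "b n = (if n < N then \<beta> else b0 n)" for n
  show thesis
  proof (rule that)
    show "n0 \<le> N" "\<And>n. N \<le> n \<Longrightarrow> b n = b0 n" "\<And>n. 0 < b n"
      unfolding N_def b_def using \<beta>(1) assms(1) by auto
    show "(\<Sum>k<n. (b k)\<^sup>2) \<le> \<epsilon>" for n
    proof -
      have "(\<Sum>k<n. (b k)\<^sup>2) = (\<Sum>k<n. if k < N then \<beta>\<^sup>2 else (b0 k)\<^sup>2)"
        by (intro sum.cong) (simp_all add: b_def)
      also have "\<dots> = (\<Sum>k\<in>{..<n} \<inter> {..<N}. \<beta>\<^sup>2) + (\<Sum>k\<in>{..<n} \<inter> - {..<N}. (b0 k)\<^sup>2)"
        by (simp add: sum.If_cases lessThan_def)
      also have "{..<n} \<inter> - {..<N} = {N..<n}" by auto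
      also have "(\<Sum>k\<in>{..<n} \<inter> {..<N}. \<beta>\<^sup>2) \<le> (\<Sum>k<N. \<beta>\<^sup>2)" by (intro sum_mono2) auto
      also have "(\<Sum>k<N. \<beta>\<^sup>2) \<le> \<epsilon> / 2" using \<beta>(2) by simp
      also have "(\<Sum>k=N..<n. (b0 k)\<^sup>2) \<le> \<epsilon> / 2" using N0[of N n] unfolding N_def by simp
      finally show ?thesis by simp
    qed
  qed
qed

lemma attains_max_if_eventually_le:
  fixes f :: "nat \<Rightarrow> real"
  assumes "\<And>\<epsilon>. 0 < \<epsilon> \<Longrightarrow> \<forall>\<^sub>F k in sequentially. f k \<le> f k0 + \<epsilon>"
  obtains k where "\<And>j. f j \<le> f k"
proof (cases "\<exists>k1. f k0 < f k1")
  case True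
  then obtain k1 where "f k0 < f k1" by blast
  then obtain N where N: "\<And>j. N \<le> j \<Longrightarrow> f j \<le> f k1"
    using assms[of "f k1 - f k0"] by (auto simp: eventually_sequentially)
  obtain k where "Max (f ` {..max N k1}) = f k"
    using obtains_MAX[of "{..max N k1}" f] by auto
  then have k: "f j \<le> f k" if "j \<le> max N k1" for j
    using Max_ge[of "f ` {..max N k1}" "f j"] that by simp
  have "f j \<le> f k" for j using N[of j] k[of j] k[of k1] by fastforce
  then show thesis by (rule that)
next
  case False
  then show thesis by (intro that[of k0]) (simp add: not_less)
qed

lemma Cauchy_if_frequently_power2_dist_le:
  fixes x :: "nat \<Rightarrow> 'a::metric_space" and G :: "nat \<Rightarrow> real"
  assumes "Cauchy G"
    and close: "\<And>\<epsilon>. 0 < \<epsilon> \<Longrightarrow>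
      \<exists>\<^sub>F m in sequentially. \<forall>n\<in>{n0..m}. (dist (x n) (x m))\<^sup>2 \<le> G n - G m + \<epsilon>"
  shows "Cauchy x"
proof (rule metric_CauchyI)
  fix \<rho> :: real assume "0 < \<rho>"
  then have "0 < \<rho>\<^sup>2 / 8" by simp
  then obtain N where N: "\<And>m n. N \<le> m \<Longrightarrow> N \<le> n \<Longrightarrow> dist (G m) (G n) < \<rho>\<^sup>2 / 8"
    using metric_CauchyD[OF \<open>Cauchy G\<close>] by metis
  have "dist (x n) (x n') < \<rho>" if n: "max N n0 \<le> n" "max N n0 \<le> n'" for n n'
  proof -
    have "\<exists>\<^sub>F m in sequentially.
        (\<forall>k\<in>{n0..m}. (dist (x k) (x m))\<^sup>2 \<le> G k - G m + \<rho>\<^sup>2 / 8) \<and> max n n' \<le> m"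
      by (rule frequently_eventually_frequently[OF close[OF \<open>0 < \<rho>\<^sup>2 / 8\<close>] eventually_ge_at_top])
    then obtain m where m: "max n n' \<le> m"
      and dist_le: "\<And>k. n0 \<le> k \<Longrightarrow> k \<le> m \<Longrightarrow> (dist (x k) (x m))\<^sup>2 \<le> G k - G m + \<rho>\<^sup>2 / 8"
      by (auto dest!: frequently_ex)
    have half: "dist (x k) (x m) < \<rho> / 2" if "max N n0 \<le> k" "k \<le> m" for k
    proof (rule power2_less_imp_less)
      have "dist (G k) (G m) < \<rho>\<^sup>2 / 8" using N[of k m] that by simp
      then have "G k - G m < \<rho>\<^sup>2 / 8" unfolding dist_real_def by linarith
      then show "(dist (x k) (x m))\<^sup>2 < (\<rho> / 2)\<^sup>2"
        using dist_le[of k] that by (simp add: power_divide)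
    qed (use \<open>0 < \<rho>\<close> in simp)
    show ?thesis by (rule dist_triangle_half_l[OF half half]) (use n m in auto)
  qed
  then show "\<exists>M. \<forall>m\<ge>M. \<forall>n\<ge>M. dist (x m) (x n) < \<rho>" by blast
qed

lemma discrete_gronwall_lower_bound:
  fixes S c a :: "nat \<Rightarrow> real"
  assumes step: "\<And>n. (1 - c n) * S n + a n \<le> S (Suc n)"
    and "\<And>n. 0 \<le> c n" "\<And>n. (\<Sum>k<n. c k) \<le> 1" "\<And>n. 0 \<le> a n" "0 \<le> S 0"
  shows "(1 - (\<Sum>k<n. c k)) * (S 0 + (\<Sum>k<n. a k)) \<le> S n"
proof (induction n)
  case 0
  then show ?case by simp
next
  case (Suc n)
  define C where "C = (\<Sum>k<n. c k)"
  define T where "T = S 0 + (\<Sum>k<n. a k)"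
  have nonneg: "0 \<le> C" "0 \<le> T"
    unfolding C_def T_def using assms by (simp_all add: add_nonneg_nonneg sum_nonneg)
  have "C + c n \<le> 1" using assms(3)[of "Suc n"] unfolding C_def by simp
  have "(1 - (C + c n)) * T \<le> (1 - c n) * ((1 - C) * T)"
  proof -
    have "0 \<le> C * c n * T" using nonneg assms(2) by simp
    then show ?thesis by (simp add: algebra_simps)
  qed
  also have "\<dots> \<le> (1 - c n) * S n"
    using Suc.IH \<open>C + c n \<le> 1\<close> nonneg unfolding C_def T_def by (intro mult_left_mono) auto
  finally have "(1 - (C + c n)) * T \<le> (1 - c n) * S n" .
  moreover have "(1 - (C + c n)) * a n \<le> a n"
    using assms(2)[of n] assms(4)[of n] nonneg \<open>C + c n \<le> 1\<close> by (intro mult_left_le_one_le) simp_all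
  ultimately have "(1 - (C + c n)) * (T + a n) \<le> (1 - c n) * S n + a n" by (simp add: distrib_left)
  also have "\<dots> \<le> S (Suc n)" by (rule step)
  finally show ?case by (simp add: C_def T_def add.assoc)
qed

section \<open>Metric projections\<close>

lemma power2_norm_diff_ge_obtuse:
  fixes x y z :: "'a::real_inner"
  assumes "(x - y) \<bullet> (z - y) \<le> 0"
  shows "(norm (x - y))\<^sup>2 + (norm (y - z))\<^sup>2 \<le> (norm (x - z))\<^sup>2"
proof -
  have "(norm (x - z))\<^sup>2 = (norm (x - y))\<^sup>2 + (norm (y - z))\<^sup>2 - 2 * ((x - y) \<bullet> (z - y))"
    unfolding power2_norm_eq_inner by (simp add: inner_simps inner_commute algebra_simps)
  with assms show ?thesis by linarith
qed

lemma
  fixes C :: "'a::real_inner set"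
  assumes "y \<in> C" and obtuse: "\<And>z. z \<in> C \<Longrightarrow> (x - y) \<bullet> (z - y) \<le> 0"
  shows metric_proj_eqI: "metric_proj C x = y"
    and infdist_eqI_obtuse: "infdist x C = norm (x - y)"
proof -
  have pythagoras: "(norm (x - y))\<^sup>2 + (norm (y - z))\<^sup>2 \<le> (norm (x - z))\<^sup>2" if "z \<in> C" for z
    using obtuse[OF that] by (rule power2_norm_diff_ge_obtuse)
  have nearest: "norm (x - y) \<le> norm (x - z)" if "z \<in> C" for z
    using pythagoras[OF that]
    by (intro power2_le_imp_le[OF _ norm_ge_zero]) (smt (verit) zero_le_power2)
  show "metric_proj C x = y"
    unfolding metric_proj_def
  proof (rule the_equality)
    fix y' assume "y' \<in> C \<and> (\<forall>z\<in>C. norm (x - y') \<le> norm (x - z))"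
    then have "(norm (x - y'))\<^sup>2 \<le> (norm (x - y))\<^sup>2" "y' \<in> C"
      using \<open>y \<in> C\<close> by (simp_all add: power_mono)
    then have "(norm (y - y'))\<^sup>2 \<le> 0" using pythagoras[of y'] by linarith
    then show "y' = y" by simp
  qed (use \<open>y \<in> C\<close> nearest in blast)
  have "C \<noteq> {}" using \<open>y \<in> C\<close> by blast
  then show "infdist x C = norm (x - y)"
    unfolding infdist_notempty[OF \<open>C \<noteq> {}\<close>]
    by (intro cInf_eq_minimum) (use \<open>y \<in> C\<close> nearest in \<open>auto simp: dist_norm\<close>)
qed

lemma convex_power2_dist_le:
  fixes C :: "'a::real_inner set"
  assumes "convex C" "y \<in> C" "z \<in> C"
  shows "(dist y z)\<^sup>2 \<le> 2 * ((dist x y)\<^sup>2 - (infdist x C)\<^sup>2) + 2 * ((dist x z)\<^sup>2 - (infdist x C)\<^sup>2)"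
proof -
  define m where "m = (1/2) *\<^sub>R y + (1/2) *\<^sub>R z"
  have "m \<in> C" unfolding m_def using convexD[OF assms, of "1/2" "1/2"] by simp
  then have "(infdist x C)\<^sup>2 \<le> (dist x m)\<^sup>2" by (intro power_mono infdist_le infdist_nonneg)
  moreover have "(dist y z)\<^sup>2 = 2 * (dist x y)\<^sup>2 + 2 * (dist x z)\<^sup>2 - 4 * (dist x m)\<^sup>2"
    unfolding m_def dist_norm power2_norm_eq_inner
    by (simp add: inner_simps inner_commute algebra_simps)
  ultimately show ?thesis by argo
qed

lemma infdist_minimizing_sequence:
  fixes C :: "'a::metric_space set"
  assumes "C \<noteq> {}"
  obtains y :: "nat \<Rightarrow> 'a" where "\<And>n. y n \<in> C" "(\<lambda>n. dist x (y n)) \<longlonglongrightarrow> infdist x C"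
proof -
  have "\<exists>y\<in>C. dist x y < infdist x C + inverse (real (Suc n))" for n
  proof (rule ccontr)
    assume "\<not> ?thesis"
    then have "infdist x C + inverse (real (Suc n)) \<le> infdist x C"
      unfolding infdist_notempty[OF assms] by (intro cINF_greatest[OF assms]) (simp add: not_less)
    then show False by simp
  qed
  then obtain y where y: "\<And>n. y n \<in> C" "\<And>n. dist x (y n) < infdist x C + inverse (real (Suc n))"
    by metis
  have "(\<lambda>n. dist x (y n)) \<longlonglongrightarrow> infdist x C"
    by (rule tendsto_sandwich[OF _ _ tendsto_const LIMSEQ_inverse_real_of_nat_add])
      (intro always_eventually allI infdist_le y(1) less_imp_le[OF y(2)])+
  with y(1) that show thesis by blast
qed

lemma infdist_attains_inf_convex:
  fixes C :: "'a::{real_inner,complete_space} set"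
  assumes "closed C" "convex C" "C \<noteq> {}"
  obtains y where "y \<in> C" "infdist x C = dist x y"
proof -
  obtain y where y: "\<And>n. y n \<in> C" and lim: "(\<lambda>n. dist x (y n)) \<longlonglongrightarrow> infdist x C"
    using infdist_minimizing_sequence[OF \<open>C \<noteq> {}\<close>] by metis
  define excess where "excess n = 2 * ((dist x (y n))\<^sup>2 - (infdist x C)\<^sup>2)" for n
  have "excess \<longlonglongrightarrow> 2 * ((infdist x C)\<^sup>2 - (infdist x C)\<^sup>2)"
    unfolding excess_def by (intro tendsto_intros lim)
  then have excess: "excess \<longlonglongrightarrow> 0" by simp
  have "Cauchy y"
  proof (rule metric_CauchyI)
    fix \<epsilon> :: real assume "0 < \<epsilon>"
    then have "\<forall>\<^sub>F n in sequentially. excess n < \<epsilon>\<^sup>2 / 2" by (intro order_tendstoD[OF excess]) simp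
    then obtain N where N: "\<And>n. N \<le> n \<Longrightarrow> excess n < \<epsilon>\<^sup>2 / 2"
      unfolding eventually_sequentially by blast
    have "dist (y m) (y n) < \<epsilon>" if "N \<le> m" "N \<le> n" for m n
    proof (rule power2_less_imp_less)
      have "(dist (y m) (y n))\<^sup>2 \<le> excess m + excess n"
        unfolding excess_def by (rule convex_power2_dist_le[OF \<open>convex C\<close> y y])
      then show "(dist (y m) (y n))\<^sup>2 < \<epsilon>\<^sup>2" using N[of m] N[of n] that by linarith
    qed (use \<open>0 < \<epsilon>\<close> in simp)
    then show "\<exists>N. \<forall>m\<ge>N. \<forall>n\<ge>N. dist (y m) (y n) < \<epsilon>" by blast
  qed
  then obtain l where l: "y \<longlonglongrightarrow> l" using Cauchy_convergent convergent_def by blast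
  show thesis
  proof (rule that)
    show "l \<in> C" using closed_sequentially[OF \<open>closed C\<close>] y l by blast
    show "infdist x C = dist x l" by (rule LIMSEQ_unique[OF lim]) (intro tendsto_intros l)
  qed
qed

lemma
  fixes C :: "'a::{real_inner,complete_space} set"
  assumes "closed C" "convex C" "C \<noteq> {}"
  shows metric_proj_in: "metric_proj C x \<in> C"
    and infdist_metric_proj: "infdist x C = norm (x - metric_proj C x)"
    and metric_proj_obtuse: "z \<in> C \<Longrightarrow> (x - metric_proj C x) \<bullet> (z - metric_proj C x) \<le> 0"
proof -
  obtain y where y: "y \<in> C" "infdist x C = dist x y" using infdist_attains_inf_convex[OF assms] .
  then have obtuse: "(x - y) \<bullet> (z - y) \<le> 0" if "z \<in> C" for z
    using any_closest_point_dot[OF \<open>convex C\<close> \<open>closed C\<close> \<open>y \<in> C\<close> that] infdist_le[of _ C x] by simp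
  then have proj: "metric_proj C x = y" using \<open>y \<in> C\<close> by (intro metric_proj_eqI)
  show "metric_proj C x \<in> C" "infdist x C = norm (x - metric_proj C x)"
    unfolding proj using y by (simp_all add: dist_norm)
  show "z \<in> C \<Longrightarrow> (x - metric_proj C x) \<bullet> (z - metric_proj C x) \<le> 0"
    unfolding proj by (rule obtuse)
qed

lemma metric_proj_pythagoras:
  fixes C :: "'a::{real_inner,complete_space} set"
  assumes "closed C" "convex C" "z \<in> C"
  shows "(norm (x - metric_proj C x))\<^sup>2 + (norm (metric_proj C x - z))\<^sup>2 \<le> (norm (x - z))\<^sup>2"
  by (intro power2_norm_diff_ge_obtuse metric_proj_obtuse) (use assms in auto)

lemma
  fixes \<phi> x :: "'a::real_inner"
  assumes "\<phi> \<noteq> 0"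
  shows metric_proj_hyperplane:
      "metric_proj {y. \<phi> \<bullet> y = c} x = x - ((\<phi> \<bullet> x - c) / (\<phi> \<bullet> \<phi>)) *\<^sub>R \<phi>"
    and infdist_hyperplane: "infdist x {y. \<phi> \<bullet> y = c} = \<bar>\<phi> \<bullet> x - c\<bar> / norm \<phi>"
proof -
  define y where "y = x - ((\<phi> \<bullet> x - c) / (\<phi> \<bullet> \<phi>)) *\<^sub>R \<phi>"
  have y: "y \<in> {y. \<phi> \<bullet> y = c}" using assms unfolding y_def by (simp add: inner_diff_right)
  have obtuse: "(x - y) \<bullet> (z - y) \<le> 0" if "z \<in> {y. \<phi> \<bullet> y = c}" for z
  proof -
    have "\<phi> \<bullet> (z - y) = 0" using that y by (simp add: inner_diff_right)
    then show ?thesis by (simp add: y_def)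
  qed
  show "metric_proj {y. \<phi> \<bullet> y = c} x = x - ((\<phi> \<bullet> x - c) / (\<phi> \<bullet> \<phi>)) *\<^sub>R \<phi>"
    using metric_proj_eqI[OF y obtuse] by (simp add: y_def)
  have "infdist x {y. \<phi> \<bullet> y = c} = norm (x - y)" by (rule infdist_eqI_obtuse[OF y obtuse])
  also have "\<dots> = \<bar>\<phi> \<bullet> x - c\<bar> / norm \<phi>"
    using assms by (simp add: y_def power2_norm_eq_inner[symmetric] power2_eq_square)
  finally show "infdist x {y. \<phi> \<bullet> y = c} = \<bar>\<phi> \<bullet> x - c\<bar> / norm \<phi>" .
qed

lemma power2_norm_metric_proj_hyperplane:
  fixes \<phi> x :: "'a::real_inner"
  assumes "\<phi> \<noteq> 0"
  shows "(norm (metric_proj {y. \<phi> \<bullet> y = 0} x))\<^sup>2 = (norm x)\<^sup>2 - (infdist x {y. \<phi> \<bullet> y = 0})\<^sup>2"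
  using assms
  unfolding metric_proj_hyperplane[OF assms] infdist_hyperplane[OF assms]
    power_divide power2_norm_eq_inner
  by (simp add: inner_diff_left inner_diff_right inner_commute[of x \<phi>] power2_eq_square)

section \<open>Projections onto quasi-symmetric sets\<close>

lemma unif_quasi_symmetric_wrt_reflect:
  assumes "unif_quasi_symmetric_wrt \<Omega> C a" "0 < r"
  obtains \<theta> where "0 < \<theta>"
    "\<And>\<alpha> y. \<alpha> \<in> \<Omega> \<Longrightarrow> y \<in> C \<alpha> \<Longrightarrow> norm (y - a) \<le> r \<Longrightarrow> a - \<theta> *\<^sub>R (y - a) \<in> C \<alpha>"
proof -
  obtain \<theta> where "0 < \<theta>" and \<theta>: "\<forall>\<alpha>\<in>\<Omega>. \<forall>z. z \<in> (\<lambda>y. y - a) ` C \<alpha> \<and> norm z \<le> r \<longrightarrow>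
      - (\<theta> *\<^sub>R z) \<in> (\<lambda>y. y - a) ` C \<alpha>"
    using assms unfolding unif_quasi_symmetric_wrt_def unif_quasi_symmetric_def by blast
  show thesis
  proof (rule that[OF \<open>0 < \<theta>\<close>])
    fix \<alpha> y assume "\<alpha> \<in> \<Omega>" "y \<in> C \<alpha>" "norm (y - a) \<le> r"
    then obtain w where "w \<in> C \<alpha>" "- (\<theta> *\<^sub>R (y - a)) = w - a" using \<theta> by blast
    then show "a - \<theta> *\<^sub>R (y - a) \<in> C \<alpha>" by (metis add.commute diff_add_cancel uminus_add_conv_diff)
  qed
qed

lemma metric_proj_inner_reflected:
  fixes C :: "'a::{real_inner,complete_space} set"
  assumes "closed C" "convex C" "a - \<theta> *\<^sub>R (y - a) \<in> C"
  shows "(norm (metric_proj C u - a))\<^sup>2 - (norm (u - a))\<^sup>2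
    \<le> 2 * (\<theta> * ((u - metric_proj C u) \<bullet> (y - a)))"
proof -
  define p where "p = metric_proj C u"
  have "(u - p) \<bullet> (a - \<theta> *\<^sub>R (y - a) - p) \<le> 0"
    unfolding p_def using assms by (intro metric_proj_obtuse) auto
  moreover have "(u - p) \<bullet> (a - \<theta> *\<^sub>R (y - a) - p)
      = - (\<theta> * ((u - p) \<bullet> (y - a))) - (u - p) \<bullet> (p - a)"
    by (simp add: inner_simps algebra_simps)
  moreover have "(norm (u - a))\<^sup>2 = (norm (u - p))\<^sup>2 + (norm (p - a))\<^sup>2 + 2 * ((u - p) \<bullet> (p - a))"
    unfolding power2_norm_eq_inner by (simp add: inner_simps inner_commute algebra_simps)
  ultimately show ?thesis
    unfolding p_def using zero_le_power2[of "norm (u - metric_proj C u)"] by linarith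
qed

text \<open>For a subspace the left-hand side would be \<open>- norm (u - P u) * \<delta>\<close>: there \<open>u - P u\<close> is orthogonal
  to \<open>P v - a\<close>.\<close>
lemma metric_proj_inner_ge_quasi_symmetric:
  fixes C :: "'a::{real_inner,complete_space} set"
  assumes "closed C" "convex C" "a \<in> C" "0 < \<theta>"
    and reflect: "\<And>y. y \<in> C \<Longrightarrow> norm (y - a) \<le> r \<Longrightarrow> a - \<theta> *\<^sub>R (y - a) \<in> C"
    and "norm (v - a) \<le> r" "infdist v C \<le> \<delta>"
  shows "((norm (metric_proj C u - a))\<^sup>2 - (norm (u - a))\<^sup>2) / (2 * \<theta>)
      - norm (u - metric_proj C u) * \<delta>
    \<le> (u - metric_proj C u) \<bullet> (v - a)"
proof -
  define p where "p = metric_proj C u"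
  define y where "y = metric_proj C v"
  have "C \<noteq> {}" using \<open>a \<in> C\<close> by blast
  have "(norm (y - a))\<^sup>2 \<le> (norm (v - a))\<^sup>2"
    using metric_proj_pythagoras[OF assms(1-3), of v] unfolding y_def
    by (smt (verit) zero_le_power2)
  then have "norm (y - a) \<le> r" using \<open>norm (v - a) \<le> r\<close> power2_le_imp_le by fastforce
  then have "a - \<theta> *\<^sub>R (y - a) \<in> C"
    unfolding y_def using metric_proj_in[OF assms(1,2) \<open>C \<noteq> {}\<close>] by (intro reflect)
  then have "(norm (p - a))\<^sup>2 - (norm (u - a))\<^sup>2 \<le> 2 * (\<theta> * ((u - p) \<bullet> (y - a)))"
    unfolding p_def by (rule metric_proj_inner_reflected[OF assms(1,2)])
  then have reflected: "((norm (p - a))\<^sup>2 - (norm (u - a))\<^sup>2) / (2 * \<theta>) \<le> (u - p) \<bullet> (y - a)"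
    using \<open>0 < \<theta>\<close> by (simp add: divide_le_eq mult_ac)
  have "norm (v - y) \<le> \<delta>"
    unfolding y_def infdist_metric_proj[OF assms(1,2) \<open>C \<noteq> {}\<close>, symmetric] by fact
  then have "norm (u - p) * norm (v - y) \<le> norm (u - p) * \<delta>" by (intro mult_left_mono) auto
  then have "- (norm (u - p) * \<delta>) \<le> (u - p) \<bullet> (v - y)"
    using Cauchy_Schwarz_ineq2[of "u - p" "v - y"] by linarith
  moreover have "(u - p) \<bullet> (v - a) = (u - p) \<bullet> (y - a) + (u - p) \<bullet> (v - y)"
    by (simp add: inner_simps algebra_simps)
  ultimately show ?thesis using reflected unfolding p_def by linarith
qed

section \<open>Condition (T) implies convergence\<close>

lemma condition_T_frequently_less:
  assumes t: "\<And>n. 0 \<le> t n" and "condition_T t"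
    and e: "\<And>n. 0 < e n" "summable (\<lambda>n. (e n)\<^sup>2)" and "0 < \<epsilon>"
  shows "\<exists>\<^sub>F m in sequentially. 0 < t m \<and> e m / t m * (\<Sum>\<nu>=1..m. e \<nu>) < \<epsilon>"
proof -
  let ?f = "\<lambda>m. ereal (e m) / ereal (t m) * ereal (\<Sum>\<nu>=1..m. e \<nu>)"
  have liminf: "liminf ?f = 0"
    using \<open>condition_T t\<close> e less_imp_le unfolding condition_T_def by blast
  have "\<exists>\<^sub>F m in sequentially. ?f m < ereal \<epsilon>"
  proof (rule ccontr)
    assume "\<not> ?thesis"
    then have "ereal \<epsilon> \<le> liminf ?f" by (intro Liminf_bounded) (simp add: not_frequently not_less)
    then show False using liminf \<open>0 < \<epsilon>\<close> by simp
  qed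
  then have "\<exists>\<^sub>F m in sequentially. ?f m < ereal \<epsilon> \<and> 1 \<le> m"
    by (rule frequently_eventually_frequently) (rule eventually_ge_at_top)
  then show ?thesis
  proof (rule frequently_elim1)
    fix m assume m: "?f m < ereal \<epsilon> \<and> 1 \<le> m"
    have partial_sum_pos: "0 < (\<Sum>\<nu>=1..m. e \<nu>)" using e(1) m by (intro sum_pos) auto
    have "t m \<noteq> 0"
    proof
      assume "t m = 0"
      then have "?f m = \<infinity>"
        using e(1)[of m] partial_sum_pos by (simp add: divide_ereal_def zero_ereal_def[symmetric])
      with m show False by (simp only:) simp
    qed
    then have "0 < t m" using t[of m] by linarith
    then show "0 < t m \<and> e m / t m * (\<Sum>\<nu>=1..m. e \<nu>) < \<epsilon>" using m by simp
  qed
qed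

text \<open>The summand \<open>2\<^sup>-\<^sup>n\<close> in the proof excludes the indices with \<open>d\<^sub>m = t\<^sub>m = 0\<close>, and it keeps
  the partial sums away from zero, so that \<open>d\<^sub>m/t\<^sub>m\<close> itself becomes small.\<close>
lemma condition_T_frequently_small:
  assumes t: "\<And>n. 0 \<le> t n" and T: "condition_T t"
    and d: "\<And>n. 0 \<le> d n" "summable (\<lambda>n. (d n)\<^sup>2)" and "0 < \<epsilon>"
  shows "\<exists>\<^sub>F m in sequentially.
    0 < t m \<and> d m / t m < \<epsilon> \<and> d m / t m * (\<Sum>\<nu>=1..m. d \<nu>) < \<epsilon>"
proof -
  define e where "e n = d n + (1/2) ^ n" for n
  have d_le: "d n \<le> e n" and e_pos: "0 < e n" for n
    unfolding e_def using d(1)[of n] by (simp_all add: add_nonneg_pos)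
  have "summable (\<lambda>n. ((1/2) ^ n :: real)\<^sup>2)"
    by (simp add: power2_eq_square flip: power_mult_distrib)
  then have "summable (\<lambda>n. (e n)\<^sup>2)" unfolding e_def by (intro summable_power2_add d(2))
  then have "\<exists>\<^sub>F m in sequentially. 0 < t m \<and> e m / t m * (\<Sum>\<nu>=1..m. e \<nu>) < \<epsilon> / 2"
    using \<open>0 < \<epsilon>\<close> by (intro condition_T_frequently_less[OF t T e_pos]) simp_all
  then have "\<exists>\<^sub>F m in sequentially. (0 < t m \<and> e m / t m * (\<Sum>\<nu>=1..m. e \<nu>) < \<epsilon> / 2) \<and> 1 \<le> m"
    by (rule frequently_eventually_frequently) (rule eventually_ge_at_top)
  then show ?thesis
  proof (rule frequently_elim1)
    fix m assume "(0 < t m \<and> e m / t m * (\<Sum>\<nu>=1..m. e \<nu>) < \<epsilon> / 2) \<and> 1 \<le> m"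
    then have m: "0 < t m" "e m / t m * (\<Sum>\<nu>=1..m. e \<nu>) < \<epsilon> / 2" "1 \<le> m" by auto
    define \<delta> where "\<delta> = d m / t m"
    define total where "total = e m / t m * (\<Sum>\<nu>=1..m. e \<nu>)"
    have \<delta>: "0 \<le> \<delta>" "\<delta> \<le> e m / t m"
      unfolding \<delta>_def using m d(1)[of m] d_le[of m] by (simp_all add: divide_right_mono)
    have "\<delta> * (\<Sum>\<nu>=1..m. d \<nu>) \<le> total"
      unfolding total_def using \<delta> d(1) d_le by (intro mult_mono sum_mono sum_nonneg) auto
    moreover have "\<delta> * (1/2) \<le> total"
      unfolding total_def
    proof (rule mult_mono)
      have "1/2 \<le> e 1" unfolding e_def using d(1)[of 1] by simp
      also have "\<dots> \<le> (\<Sum>\<nu>=1..m. e \<nu>)" using m e_pos less_imp_le by (intro member_le_sum) auto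
      finally show "1/2 \<le> (\<Sum>\<nu>=1..m. e \<nu>)" .
    qed (use \<delta> in auto)
    moreover have "total < \<epsilon> / 2" unfolding total_def by (rule m(2))
    ultimately show "0 < t m \<and> d m / t m < \<epsilon> \<and> d m / t m * (\<Sum>\<nu>=1..m. d \<nu>) < \<epsilon>"
      unfolding \<delta>_def[symmetric] using m(1) \<open>0 < \<epsilon>\<close> by (intro conjI) linarith+
  qed
qed

locale remote_projection_sequence =
  fixes \<Omega> :: "'i set" and C :: "'i \<Rightarrow> 'a::{real_inner,complete_space} set"
    and a :: 'a and t :: "nat \<Rightarrow> real" and x :: "nat \<Rightarrow> 'a" and \<alpha> :: "nat \<Rightarrow> 'i"
  assumes closed_convex: "\<And>\<beta>. \<beta> \<in> \<Omega> \<Longrightarrow> closed (C \<beta>)" "\<And>\<beta>. \<beta> \<in> \<Omega> \<Longrightarrow> convex (C \<beta>)"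
    and quasi_symmetric: "unif_quasi_symmetric_wrt \<Omega> C a"
    and weakness_nonneg: "\<And>n. 0 \<le> t n"
    and index: "\<And>n. \<alpha> n \<in> \<Omega>"
    and remote: "\<And>n. t n * (SUP \<beta>\<in>\<Omega>. infdist (x n) (C \<beta>)) \<le> infdist (x n) (C (\<alpha> n))"
    and step: "\<And>n. x (Suc n) = metric_proj (C (\<alpha> n)) (x n)"
begin

lemma center_in: "\<beta> \<in> \<Omega> \<Longrightarrow> a \<in> C \<beta>"
  using quasi_symmetric unfolding unif_quasi_symmetric_wrt_def by blast

definition step_length :: "nat \<Rightarrow> real" where
  "step_length n = norm (x n - x (Suc n))"

lemma infdist_eq_step_length: "infdist (x n) (C (\<alpha> n)) = step_length n"
  unfolding step_length_def step using closed_convex index center_in[OF index[of n]]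
  by (intro infdist_metric_proj) auto

lemma step_length_pythagoras: "(step_length n)\<^sup>2 + (norm (x (Suc n) - a))\<^sup>2 \<le> (norm (x n - a))\<^sup>2"
  unfolding step_length_def step using closed_convex index center_in
  by (intro metric_proj_pythagoras) auto

lemma decseq_power2_norm: "decseq (\<lambda>n. (norm (x n - a))\<^sup>2)"
  unfolding decseq_Suc_iff using step_length_pythagoras by (smt (verit) zero_le_power2)

lemma norm_le_start: "norm (x n - a) \<le> norm (x 0 - a)"
  using decseqD[OF decseq_power2_norm, of 0 n] by (auto intro: power2_le_imp_le)

lemma summable_power2_step_length: "summable (\<lambda>n. (step_length n)\<^sup>2)"
proof (rule summableI_nonneg_bounded)
  fix n
  have "(\<Sum>k<n. (step_length k)\<^sup>2) \<le> (norm (x 0 - a))\<^sup>2 - (norm (x n - a))\<^sup>2"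
  proof (induction n)
    case (Suc n) then show ?case using step_length_pythagoras[of n] by simp
  qed simp
  then show "(\<Sum>k<n. (step_length k)\<^sup>2) \<le> (norm (x 0 - a))\<^sup>2" by (smt (verit) zero_le_power2)
qed simp

lemma infdist_le_step_length:
  assumes "\<beta> \<in> \<Omega>" "0 < t n"
  shows "infdist (x n) (C \<beta>) \<le> step_length n / t n"
proof -
  have "bdd_above ((\<lambda>\<beta>. infdist (x n) (C \<beta>)) ` \<Omega>)"
    using center_in by (intro bdd_aboveI2[of _ _ "dist (x n) a"] infdist_le)
  then have "infdist (x n) (C \<beta>) \<le> (SUP \<beta>\<in>\<Omega>. infdist (x n) (C \<beta>))"
    using \<open>\<beta> \<in> \<Omega>\<close> by (rule cSUP_upper[rotated])
  then have "t n * infdist (x n) (C \<beta>) \<le> t n * (SUP \<beta>\<in>\<Omega>. infdist (x n) (C \<beta>))"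
    using weakness_nonneg by (rule mult_left_mono)
  also have "\<dots> \<le> step_length n" using remote[of n] unfolding infdist_eq_step_length .
  finally show ?thesis using \<open>0 < t n\<close> by (simp add: le_divide_eq mult.commute)
qed

lemma power2_dist_le_norm_decrease:
  assumes "0 < \<theta>" "n \<le> m"
    and "\<And>\<beta> y. \<beta> \<in> \<Omega> \<Longrightarrow> y \<in> C \<beta> \<Longrightarrow> norm (y - a) \<le> r \<Longrightarrow> a - \<theta> *\<^sub>R (y - a) \<in> C \<beta>"
    and "norm (x m - a) \<le> r" and "\<And>\<beta>. \<beta> \<in> \<Omega> \<Longrightarrow> infdist (x m) (C \<beta>) \<le> \<delta>"
  shows "(dist (x n) (x m))\<^sup>2
    \<le> (1 + 1 / \<theta>) * ((norm (x n - a))\<^sup>2 - (norm (x m - a))\<^sup>2) + 2 * (\<delta> * (\<Sum>k=n..<m. step_length k))"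
proof -
  define G where "G k = (norm (x k - a))\<^sup>2" for k
  have "(G m - G n) / (2 * \<theta>) - \<delta> * (\<Sum>k=n..<m. step_length k)
      = (\<Sum>k=n..<m. (G (Suc k) - G k) / (2 * \<theta>) - step_length k * \<delta>)"
    using sum_Suc_diff'[OF \<open>n \<le> m\<close>, of G]
    by (simp add: sum_subtractf sum_distrib_left mult.commute flip: sum_divide_distrib)
  also have "\<dots> \<le> (\<Sum>k=n..<m. (x k - x (Suc k)) \<bullet> (x m - a))"
    unfolding G_def step_length_def step using closed_convex index center_in assms
    by (intro sum_mono metric_proj_inner_ge_quasi_symmetric[where r = r]) auto
  also have "\<dots> = (x n - x m) \<bullet> (x m - a)"
    using sum_Suc_diff'[OF \<open>n \<le> m\<close>, of "\<lambda>k. - x k"] by (simp flip: inner_sum_left)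
  finally have "(G m - G n) / \<theta> - 2 * (\<delta> * (\<Sum>k=n..<m. step_length k))
      \<le> 2 * ((x n - x m) \<bullet> (x m - a))"
    by simp
  moreover have "(dist (x n) (x m))\<^sup>2 = G n - G m - 2 * ((x n - x m) \<bullet> (x m - a))"
    unfolding G_def dist_norm power2_norm_eq_inner
    by (simp add: inner_simps inner_commute algebra_simps)
  ultimately show ?thesis
    unfolding G_def[symmetric] by (simp add: distrib_right diff_divide_distrib)
qed

lemma frequently_small_steps:
  assumes "condition_T t" "0 < \<epsilon>"
  shows "\<exists>\<^sub>F m in sequentially. 0 < t m \<and> step_length m / t m < \<epsilon>
    \<and> step_length m / t m * (\<Sum>\<nu>=1..m. step_length \<nu>) < \<epsilon>"
  using assms by (intro condition_T_frequently_small weakness_nonneg summable_power2_step_length)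
    (simp_all add: step_length_def)

lemma power2_dist_le_small_step:
  assumes "0 < \<theta>" "n \<in> {1..m}" "0 < t m"
    and reflect: "\<And>\<beta> y. \<beta> \<in> \<Omega> \<Longrightarrow> y \<in> C \<beta> \<Longrightarrow> norm (y - a) \<le> norm (x 0 - a) \<Longrightarrow>
      a - \<theta> *\<^sub>R (y - a) \<in> C \<beta>"
    and small: "step_length m / t m * (\<Sum>\<nu>=1..m. step_length \<nu>) < \<epsilon> / 2"
  shows "(dist (x n) (x m))\<^sup>2 \<le> (1 + 1 / \<theta>) * ((norm (x n - a))\<^sup>2 - (norm (x m - a))\<^sup>2) + \<epsilon>"
proof -
  have "(\<Sum>k=n..<m. step_length k) \<le> (\<Sum>\<nu>=1..m. step_length \<nu>)"
    using assms(2) by (intro sum_mono2) (auto simp: step_length_def)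
  then have "step_length m / t m * (\<Sum>k=n..<m. step_length k)
      \<le> step_length m / t m * (\<Sum>\<nu>=1..m. step_length \<nu>)"
    using \<open>0 < t m\<close> by (intro mult_left_mono) (simp_all add: step_length_def)
  moreover have "(dist (x n) (x m))\<^sup>2 \<le> (1 + 1 / \<theta>) * ((norm (x n - a))\<^sup>2 - (norm (x m - a))\<^sup>2)
      + 2 * (step_length m / t m * (\<Sum>k=n..<m. step_length k))"
    using assms(1-3) infdist_le_step_length norm_le_start
    by (intro power2_dist_le_norm_decrease reflect) auto
  ultimately show ?thesis using small by linarith
qed

lemma condition_T_imp_Cauchy:
  assumes "condition_T t"
  shows "Cauchy x"
proof -
  obtain \<theta> where "0 < \<theta>" and reflect: "\<And>\<beta> y. \<beta> \<in> \<Omega> \<Longrightarrow> y \<in> C \<beta> \<Longrightarrow>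
      norm (y - a) \<le> norm (x 0 - a) + 1 \<Longrightarrow> a - \<theta> *\<^sub>R (y - a) \<in> C \<beta>"
    using unif_quasi_symmetric_wrt_reflect[OF quasi_symmetric, of "norm (x 0 - a) + 1"]
    by (metis add_nonneg_pos norm_ge_zero zero_less_one)
  define G where "G n = (1 + 1 / \<theta>) * (norm (x n - a))\<^sup>2" for n
  have "Cauchy (\<lambda>n. (norm (x n - a))\<^sup>2)"
    using decseq_convergent[OF decseq_power2_norm, of 0] LIMSEQ_imp_Cauchy by (metis zero_le_power2)
  then have "Cauchy G"
    unfolding G_def Cauchy_convergent_iff by (intro convergent_mult convergent_const)
  moreover have "\<exists>\<^sub>F m in sequentially. \<forall>n\<in>{1..m}. (dist (x n) (x m))\<^sup>2 \<le> G n - G m + \<epsilon>"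
    if "0 < \<epsilon>" for \<epsilon>
    unfolding G_def right_diff_distrib[symmetric]
  proof (rule frequently_elim1)
    show "\<exists>\<^sub>F m in sequentially. 0 < t m \<and> step_length m / t m < \<epsilon> / 2
        \<and> step_length m / t m * (\<Sum>\<nu>=1..m. step_length \<nu>) < \<epsilon> / 2"
      using that by (intro frequently_small_steps assms) simp
  qed (use \<open>0 < \<theta>\<close> reflect power2_dist_le_small_step in auto)
  ultimately show ?thesis by (rule Cauchy_if_frequently_power2_dist_le)
qed

lemma condition_T_imp_limit_in:
  assumes "condition_T t" "x \<longlonglongrightarrow> z" "\<beta> \<in> \<Omega>"
  shows "z \<in> C \<beta>"
proof (rule ccontr)
  assume "z \<notin> C \<beta>"
  then have "0 < infdist z (C \<beta>)"
    using closed_convex center_in[OF \<open>\<beta> \<in> \<Omega>\<close>] \<open>\<beta> \<in> \<Omega>\<close> by (intro infdist_pos_not_in_closed) auto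
  then have half: "infdist z (C \<beta>) / 2 < infdist z (C \<beta>)" "0 < infdist z (C \<beta>) / 2" by simp_all
  have "\<forall>\<^sub>F m in sequentially. infdist z (C \<beta>) / 2 < infdist (x m) (C \<beta>)"
    by (rule order_tendstoD(1)[OF tendsto_infdist[OF \<open>x \<longlonglongrightarrow> z\<close>] half(1)])
  from frequently_ex[OF frequently_eventually_conj[OF frequently_small_steps[OF assms(1) half(2)] this]]
  obtain m where "0 < t m" "step_length m / t m < infdist z (C \<beta>) / 2"
    "infdist z (C \<beta>) / 2 < infdist (x m) (C \<beta>)" by blast
  then show False using infdist_le_step_length[OF \<open>\<beta> \<in> \<Omega>\<close>, of m] by linarith
qed

end

theorem condition_T_imp_remote_projections_converge:
  assumes "\<And>n. 0 \<le> t n" "condition_T t"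
  shows "remote_projections_converge t TYPE('a::{real_inner,complete_space}) TYPE('i)"
  unfolding remote_projections_converge_def
proof (intro allI impI, elim conjE)
  fix \<Omega> :: "'i set" and C :: "'i \<Rightarrow> 'a set" and a x0 x
  assume C: "\<forall>\<beta>\<in>\<Omega>. closed (C \<beta>) \<and> convex (C \<beta>)" and sym: "unif_quasi_symmetric_wrt \<Omega> C a"
    and "remote_projections \<Omega> C t x0 x"
  then obtain \<alpha> where "\<And>n. \<alpha> n \<in> \<Omega>" "\<And>n. x (Suc n) = metric_proj (C (\<alpha> n)) (x n)"
    "\<And>n. t n * (SUP \<beta>\<in>\<Omega>. infdist (x n) (C \<beta>)) \<le> infdist (x n) (C (\<alpha> n))"
    unfolding remote_projections_def by metis
  with C sym assms(1) interpret remote_projection_sequence \<Omega> C a t x \<alpha>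
    by unfold_locales auto
  obtain z where "x \<longlonglongrightarrow> z"
    using condition_T_imp_Cauchy[OF assms(2)] Cauchy_convergent convergent_def by blast
  with condition_T_imp_limit_in[OF assms(2)] show "\<exists>z\<in>(\<Inter>\<beta>\<in>\<Omega>. C \<beta>). x \<longlonglongrightarrow> z" by blast
qed

section \<open>Failure of condition (T)\<close>

lemma not_condition_T_obtain:
  assumes t: "\<And>n. 0 \<le> t n" and "\<not> condition_T t"
  obtains a :: "nat \<Rightarrow> real" and c where "\<And>n. 0 \<le> a n" "summable (\<lambda>n. (a n)\<^sup>2)" "0 < c"
    "\<forall>\<^sub>F n in sequentially. c * t n \<le> a n * (\<Sum>\<nu>=1..n. a \<nu>)"
proof -
  obtain a :: "nat \<Rightarrow> real" where a: "\<And>\<nu>. 1 \<le> \<nu> \<Longrightarrow> 0 \<le> a \<nu>" "summable (\<lambda>\<nu>. (a \<nu>)\<^sup>2)"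
    and liminf: "liminf (\<lambda>m. ereal (a m) / ereal (t m) * ereal (\<Sum>\<nu>=1..m. a \<nu>)) \<noteq> 0"
    using assms(2) unfolding condition_T_def by blast
  let ?f = "\<lambda>m. ereal (a m) / ereal (t m) * ereal (\<Sum>\<nu>=1..m. a \<nu>)"
  have partial_sum_nonneg: "0 \<le> (\<Sum>\<nu>=1..m. a \<nu>)" for m using a(1) by (intro sum_nonneg) auto
  have "0 \<le> ?f m" if "1 \<le> m" for m
    using a(1)[OF that] t[of m] partial_sum_nonneg[of m] by (cases "t m = 0") auto
  then have "0 \<le> liminf ?f" by (intro Liminf_bounded eventually_sequentiallyI[of 1])
  with liminf have "0 < liminf ?f" by simp
  then obtain c where c: "0 < c" "ereal c < liminf ?f"
    using ereal_dense2[of 0 "liminf ?f"] by (auto simp: zero_ereal_def)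
  have "\<forall>\<^sub>F m in sequentially. c * t m \<le> \<bar>a m\<bar> * (\<Sum>\<nu>=1..m. \<bar>a \<nu>\<bar>)"
    using less_LiminfD[OF c(2)] eventually_ge_at_top[of 1]
  proof eventually_elim
    case (elim m)
    have "c * t m \<le> a m * (\<Sum>\<nu>=1..m. a \<nu>)"
    proof (cases "t m = 0")
      case True
      then show ?thesis using a(1)[OF elim(2)] partial_sum_nonneg[of m] by simp
    next
      case False
      then have "0 < t m" using t[of m] by simp
      moreover from this have "c < a m * (\<Sum>\<nu>=1..m. a \<nu>) / t m" using elim(1) by simp
      ultimately show ?thesis by (simp add: field_simps)
    qed
    then show ?case using a(1) elim(2) by simp
  qed
  with c(1) a(2) show thesis by (intro that[of "\<lambda>n. \<bar>a n\<bar>"]) auto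
qed

lemma not_condition_T_obtain_divergent:
  assumes "\<And>n. 0 \<le> t n" "\<not> condition_T t" "0 < c"
  obtains b :: "nat \<Rightarrow> real" where "\<And>n. 0 < b n" "summable (\<lambda>n. (b n)\<^sup>2)"
    "filterlim (\<lambda>n. \<Sum>k<n. b k) at_top sequentially"
    "\<forall>\<^sub>F n in sequentially. c * t n \<le> b n * (\<Sum>k\<le>n. b k)"
proof -
  obtain a c' where a: "\<And>n. 0 \<le> a n" "summable (\<lambda>n. (a n)\<^sup>2)" and "0 < c'"
    and a_t: "\<forall>\<^sub>F n in sequentially. c' * t n \<le> a n * (\<Sum>\<nu>=1..n. a \<nu>)"
    using not_condition_T_obtain[OF assms(1,2)] by metis
  define \<kappa> where "\<kappa> = sqrt (c / c')"
  have \<kappa>: "0 < \<kappa>" "\<kappa>\<^sup>2 = c / c'" unfolding \<kappa>_def using \<open>0 < c\<close> \<open>0 < c'\<close> by simp_all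
  define b0 where "b0 n = a n + inverse (real (Suc n))" for n
  have a_le: "a n \<le> b0 n" and b0: "0 < b0 n" for n
    unfolding b0_def using a(1)[of n] by (simp_all add: add_nonneg_pos)
  have b0_t: "c * t n \<le> \<kappa> * b0 n * (\<Sum>k\<le>n. \<kappa> * b0 k)"
    if "c' * t n \<le> a n * (\<Sum>\<nu>=1..n. a \<nu>)" for n
  proof -
    have "(\<Sum>\<nu>=1..n. a \<nu>) \<le> (\<Sum>\<nu>=1..n. b0 \<nu>)" by (intro sum_mono a_le)
    also have "\<dots> \<le> (\<Sum>k\<le>n. b0 k)" using b0 less_imp_le by (intro sum_mono2) auto
    finally have "a n * (\<Sum>\<nu>=1..n. a \<nu>) \<le> b0 n * (\<Sum>k\<le>n. b0 k)"
      using a(1) less_imp_le[OF b0] by (intro mult_mono sum_nonneg a_le)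
    with that have "c' * t n \<le> b0 n * (\<Sum>k\<le>n. b0 k)" by linarith
    then have "\<kappa>\<^sup>2 * (c' * t n) \<le> \<kappa>\<^sup>2 * (b0 n * (\<Sum>k\<le>n. b0 k))" by (intro mult_left_mono) auto
    also have "\<dots> = \<kappa> * b0 n * (\<Sum>k\<le>n. \<kappa> * b0 k)"
      by (simp add: power2_eq_square mult_ac flip: sum_distrib_left)
    also have "\<kappa>\<^sup>2 * (c' * t n) = c * t n" unfolding \<kappa>(2) using \<open>0 < c'\<close> by simp
    finally show ?thesis .
  qed
  show thesis
  proof (rule that[OF _ _ _ eventually_mono[OF a_t b0_t]])
    show "0 < \<kappa> * b0 n" for n using \<kappa> b0 by simp
    show "summable (\<lambda>n. (\<kappa> * b0 n)\<^sup>2)"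
      unfolding b0_def power_mult_distrib
      by (intro summable_mult summable_power2_add a(2) summable_power2_inverse_Suc)
    have "filterlim (\<lambda>n. \<Sum>k<n. b0 k) at_top sequentially"
      using a(1) by (intro filterlim_sum_at_top_if_ge_inverse_Suc) (simp add: b0_def)
    then show "filterlim (\<lambda>n. \<Sum>k<n. \<kappa> * b0 k) at_top sequentially"
      unfolding sum_distrib_left[symmetric]
      by (rule filterlim_tendsto_pos_mult_at_top[OF tendsto_const \<kappa>(1)])
  qed
qed

lemma weight_offset_exists:
  fixes b b0 t :: "nat \<Rightarrow> real"
  assumes b: "\<And>n. 0 < b n" "\<And>n. b n \<le> B" and b0: "\<And>n. 0 \<le> b0 n" "\<And>n. N \<le> n \<Longrightarrow> b n = b0 n"
    and t: "\<And>n. t n \<le> 1" "\<And>n. N \<le> n \<Longrightarrow> c * t n \<le> b0 n * (\<Sum>k\<le>n. b0 k)" and "0 < c"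
  shows "\<exists>q. \<forall>n. c * t n \<le> b n * (q + (\<Sum>k<n. b k))"
proof (intro exI allI)
  define q where "q = (\<Sum>k<N. c / b k) + (\<Sum>k<N. b0 k) + B"
  fix n
  have quotient_nonneg: "0 \<le> c / b k" for k using \<open>0 < c\<close> less_imp_le[OF b(1)[of k]] by simp
  show "c * t n \<le> b n * (q + (\<Sum>k<n. b k))"
  proof (cases "n < N")
    case True
    have "c / b n \<le> (\<Sum>k<N. c / b k)"
      using True quotient_nonneg by (intro member_le_sum) auto
    also have "\<dots> \<le> q + (\<Sum>k<n. b k)"
      unfolding q_def
      using b0(1) less_imp_le[OF b(1)] b(2) order_trans[OF less_imp_le[OF b(1)] b(2)]
      by (simp add: add_nonneg_nonneg sum_nonneg)
    finally have "b n * (c / b n) \<le> b n * (q + (\<Sum>k<n. b k))"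
      using less_imp_le[OF b(1)] by (rule mult_left_mono)
    moreover have "c * t n \<le> b n * (c / b n)" using \<open>0 < c\<close> t(1)[of n] b(1)[of n] by simp
    ultimately show ?thesis by linarith
  next
    case False
    have "0 \<le> (\<Sum>k<N. c / b k)" by (intro sum_nonneg quotient_nonneg)
    moreover have "(\<Sum>k<n. b0 k) \<le> (\<Sum>k<N. b0 k) + (\<Sum>k<n. b k)"
      using less_imp_le[OF b(1)] b0 by (rule sum_le_if_eq_from)
    ultimately have "(\<Sum>k\<le>n. b0 k) \<le> q + (\<Sum>k<n. b k)"
      unfolding q_def lessThan_Suc_atMost[symmetric] sum.lessThan_Suc
      using b(2)[of n] b0(2)[of n] False by linarith
    then have "b n * (\<Sum>k\<le>n. b0 k) \<le> b n * (q + (\<Sum>k<n. b k))"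
      using less_imp_le[OF b(1)] by (rule mult_left_mono)
    then show ?thesis using t(2)[of n] b0(2)[of n] False by simp
  qed
qed

text \<open>The offset \<open>q\<close> compensates for making finitely many weights small.\<close>
lemma not_condition_T_obtain_weights:
  assumes t: "\<And>n. 0 \<le> t n" "\<And>n. t n \<le> 1" and "\<not> condition_T t" "0 < c" "0 < \<epsilon>"
  obtains b :: "nat \<Rightarrow> real" and q :: real where "\<And>n. 0 < b n" "\<And>n. (\<Sum>k<n. (b k)\<^sup>2) \<le> \<epsilon>"
    "filterlim (\<lambda>n. \<Sum>k<n. b k) at_top sequentially"
    "\<And>n. c * t n \<le> b n * (q + (\<Sum>k<n. b k))"
proof -
  obtain b0 :: "nat \<Rightarrow> real" where b0: "\<And>n. 0 < b0 n" "summable (\<lambda>n. (b0 n)\<^sup>2)"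
    and diverges: "filterlim (\<lambda>n. \<Sum>k<n. b0 k) at_top sequentially"
    and "\<forall>\<^sub>F n in sequentially. c * t n \<le> b0 n * (\<Sum>k\<le>n. b0 k)"
    using not_condition_T_obtain_divergent[OF t(1) assms(3,4)] by metis
  then obtain n0 where n0: "\<And>n. n0 \<le> n \<Longrightarrow> c * t n \<le> b0 n * (\<Sum>k\<le>n. b0 k)"
    unfolding eventually_sequentially by blast
  obtain b N where "n0 \<le> N" and b_eq: "\<And>n. N \<le> n \<Longrightarrow> b n = b0 n"
    and b: "\<And>n. 0 < b n" "\<And>n. (\<Sum>k<n. (b k)\<^sup>2) \<le> \<epsilon>"
    using summable_power2_modify_initial[OF b0 \<open>0 < \<epsilon>\<close>] by metis
  have "(b n)\<^sup>2 \<le> \<epsilon>" for n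
    using b(2)[of "Suc n"] sum_nonneg[of "{..<n}" "\<lambda>k. (b k)\<^sup>2"] by simp
  then have b_le: "b n \<le> sqrt \<epsilon>" for n by (intro real_le_rsqrt)
  obtain q where q: "\<And>n. c * t n \<le> b n * (q + (\<Sum>k<n. b k))"
    using weight_offset_exists[OF b(1) b_le less_imp_le[OF b0(1)] b_eq t(2)
        n0[OF order_trans[OF \<open>n0 \<le> N\<close>]] \<open>0 < c\<close>] by blast
  have "filterlim (\<lambda>n. - (\<Sum>k<N. b0 k) + (\<Sum>k<n. b0 k)) at_top sequentially"
    by (rule filterlim_tendsto_add_at_top[OF tendsto_const diverges])
  then have "filterlim (\<lambda>n. \<Sum>k<n. b k) at_top sequentially"
  proof (rule filterlim_at_top_mono[OF _ always_eventually], intro allI)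
    show "- (\<Sum>k<N. b0 k) + (\<Sum>k<n. b0 k) \<le> (\<Sum>k<n. b k)" for n
      using sum_le_if_eq_from[of b b0 N n] less_imp_le[OF b(1)] less_imp_le[OF b0(1)] b_eq by simp
  qed
  with b q show thesis by (intro that)
qed

section \<open>Orthonormal families\<close>

definition orthonormal_on :: "'i set \<Rightarrow> ('i \<Rightarrow> 'a::real_inner) \<Rightarrow> bool" where
  "orthonormal_on I e \<longleftrightarrow> (\<forall>i\<in>I. \<forall>j\<in>I. e i \<bullet> e j = (if i = j then 1 else 0))"

lemma orthonormal_onD:
  "orthonormal_on I e \<Longrightarrow> i \<in> I \<Longrightarrow> j \<in> I \<Longrightarrow> e i \<bullet> e j = (if i = j then 1 else 0)"
  unfolding orthonormal_on_def by blast

lemma orthonormal_on_subset: "orthonormal_on J e \<Longrightarrow> I \<subseteq> J \<Longrightarrow> orthonormal_on I e"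
  unfolding orthonormal_on_def by blast

lemma orthonormal_on_linorderI:
  fixes I :: "'i::linorder set"
  assumes norm: "\<And>i. i \<in> I \<Longrightarrow> norm (e i) = 1"
    and orth: "\<And>i j. i \<in> I \<Longrightarrow> j \<in> I \<Longrightarrow> j < i \<Longrightarrow> e i \<bullet> e j = 0"
  shows "orthonormal_on I e"
  unfolding orthonormal_on_def
proof (intro ballI)
  fix i j assume "i \<in> I" "j \<in> I"
  then show "e i \<bullet> e j = (if i = j then 1 else 0)"
    using norm[of i] orth[of i j] orth[of j i]
    by (cases i j rule: linorder_cases) (simp_all add: dot_square_norm inner_commute)
qed

lemma orthonormal_on_inner_sum:
  assumes "orthonormal_on I e" "finite I" "j \<in> I"
  shows "(\<Sum>i\<in>I. c i *\<^sub>R e i) \<bullet> e j = c j"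
proof -
  have "(\<Sum>i\<in>I. c i *\<^sub>R e i) \<bullet> e j = (\<Sum>i\<in>I. if i = j then c j else 0)"
    unfolding inner_sum_left using orthonormal_onD[OF assms(1) _ assms(3)] by (intro sum.cong) auto
  then show ?thesis using assms by simp
qed

lemma orthonormal_on_residual_orthogonal:
  assumes "orthonormal_on I e" "finite I" "j \<in> I"
  shows "(x - (\<Sum>i\<in>I. (x \<bullet> e i) *\<^sub>R e i)) \<bullet> e j = 0"
  by (simp add: inner_diff_left orthonormal_on_inner_sum[OF assms])

lemma power2_norm_orthonormal_sum:
  assumes "orthonormal_on I e" "finite I"
  shows "(norm (\<Sum>i\<in>I. c i *\<^sub>R e i))\<^sup>2 = (\<Sum>i\<in>I. (c i)\<^sup>2)"
proof -
  define s where "s = (\<Sum>i\<in>I. c i *\<^sub>R e i)"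
  have "s \<bullet> s = (\<Sum>i\<in>I. c i * (s \<bullet> e i))" by (subst (2) s_def) (simp add: inner_sum_right)
  also have "\<dots> = (\<Sum>i\<in>I. (c i)\<^sup>2)"
    unfolding s_def
    by (intro sum.cong) (simp_all add: orthonormal_on_inner_sum[OF assms] power2_eq_square)
  finally show ?thesis by (simp add: s_def power2_norm_eq_inner)
qed

lemma bessel_inequality:
  assumes "orthonormal_on I e" "finite I"
  shows "(\<Sum>i\<in>I. (x \<bullet> e i)\<^sup>2) \<le> (norm x)\<^sup>2"
proof -
  define s where "s = (\<Sum>i\<in>I. (x \<bullet> e i) *\<^sub>R e i)"
  have "(x - s) \<bullet> s = 0"
    by (subst (2) s_def)
      (simp add: inner_sum_right s_def orthonormal_on_residual_orthogonal[OF assms])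
  then have "(norm x)\<^sup>2 = (norm (x - s))\<^sup>2 + (norm s)\<^sup>2"
    unfolding power2_norm_eq_inner by (simp add: inner_diff_left inner_diff_right inner_commute)
  then show ?thesis
    using power2_norm_orthonormal_sum[OF assms] unfolding s_def
    by (metis le_add_same_cancel2 zero_le_power2)
qed

lemma orthonormal_expansion:
  assumes "orthonormal_on I e" "finite I" "x \<in> span (e ` I)"
  shows "(\<Sum>i\<in>I. (x \<bullet> e i) *\<^sub>R e i) = x"
proof -
  define r where "r = x - (\<Sum>i\<in>I. (x \<bullet> e i) *\<^sub>R e i)"
  have "r \<in> span (e ` I)"
    unfolding r_def by (intro span_diff[OF assms(3)] span_sum span_scale span_base) auto
  then have "orthogonal r r"
    by (rule orthogonal_to_span)
      (auto simp: orthogonal_def r_def orthonormal_on_residual_orthogonal[OF assms(1,2)])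
  then show ?thesis by (simp add: orthogonal_def r_def)
qed

lemma parseval:
  assumes "orthonormal_on I e" "finite I" "x \<in> span (e ` I)"
  shows "(norm x)\<^sup>2 = (\<Sum>i\<in>I. (x \<bullet> e i)\<^sup>2)"
  using power2_norm_orthonormal_sum[OF assms(1,2), of "\<lambda>i. x \<bullet> e i"]
  unfolding orthonormal_expansion[OF assms] .

lemma infinite_dimensional_orthonormal_sequence:
  assumes "infinite_dimensional TYPE('a::real_inner)"
  obtains e :: "nat \<Rightarrow> 'a::real_inner" where "orthonormal_on UNIV e"
proof -
  have "\<exists>e :: nat \<Rightarrow> 'a. \<forall>n. norm (e n) = 1 \<and> (\<forall>k<n. e n \<bullet> e k = 0)"
  proof (rule dependent_wellorder_choice)
    fix n :: nat and e :: "nat \<Rightarrow> 'a"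
    assume "\<And>m. m < n \<Longrightarrow> norm (e m) = 1 \<and> (\<forall>k<m. e m \<bullet> e k = 0)"
    then have e: "orthonormal_on {..<n} e" by (intro orthonormal_on_linorderI) auto
    have "span (e ` {..<n}) \<noteq> UNIV"
      using assms unfolding infinite_dimensional_def by (metis finite_imageI finite_lessThan)
    then obtain v where v: "v \<notin> span (e ` {..<n})" by blast
    define w where "w = v - (\<Sum>k<n. (v \<bullet> e k) *\<^sub>R e k)"
    have "(\<Sum>k<n. (v \<bullet> e k) *\<^sub>R e k) \<in> span (e ` {..<n})"
      by (intro span_sum span_scale span_base) auto
    then have "w \<noteq> 0" using v unfolding w_def by auto
    moreover have "\<forall>k<n. w \<bullet> e k = 0"
      unfolding w_def using orthonormal_on_residual_orthogonal[OF e] by simp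
    ultimately show "\<exists>u. norm u = 1 \<and> (\<forall>k<n. u \<bullet> e k = 0)"
      by (intro exI[of _ "(1 / norm w) *\<^sub>R w"]) simp
  qed simp
  then show thesis using that by (metis orthonormal_on_linorderI)
qed

locale orthonormal_sequence =
  fixes e :: "nat \<Rightarrow> 'a::real_inner"
  assumes orthonormal: "orthonormal_on UNIV e"
begin

lemma orthonormal_on: "orthonormal_on I e"
  using orthonormal by (rule orthonormal_on_subset) simp

lemma inner_e [simp]: "e i \<bullet> e j = (if i = j then 1 else 0)"
  by (rule orthonormal_onD[OF orthonormal]) simp_all

lemma norm_e [simp]: "norm (e i) = 1"
  by (simp add: norm_eq_sqrt_inner)

lemma e_nonzero [simp]: "e i \<noteq> 0"
  using norm_e[of i] by force

lemma inner_tendsto_zero: "(\<lambda>i. x \<bullet> e i) \<longlonglongrightarrow> 0"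
proof -
  have "summable (\<lambda>i. (x \<bullet> e i)\<^sup>2)"
    using bessel_inequality[OF orthonormal_on finite_lessThan]
    by (intro summableI_nonneg_bounded) auto
  then have "(\<lambda>i. (x \<bullet> e i)\<^sup>2) \<longlonglongrightarrow> 0" by (rule summable_LIMSEQ_zero)
  then have "(\<lambda>i. \<bar>x \<bullet> e i\<bar>) \<longlonglongrightarrow> 0" using tendsto_real_sqrt by fastforce
  then show ?thesis by (rule tendsto_rabs_zero_cancel)
qed

lemma inner_eq_0_if_in_span: "x \<in> span (e ` I) \<Longrightarrow> k \<notin> I \<Longrightarrow> x \<bullet> e k = 0"
  using orthogonal_to_span[of x "e ` I" "e k"] by (force simp: orthogonal_def inner_commute[of x])

end

section \<open>Splitting the largest coordinate\<close>

context orthonormal_sequence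
begin

definition coord_sum :: "'a \<Rightarrow> nat \<Rightarrow> real" where
  "coord_sum x L = (\<Sum>k\<le>L. x \<bullet> e k)"

lemma coord_sum_extend:
  assumes "x \<in> span (e ` {..L})" "L \<le> L'"
  shows "coord_sum x L' = coord_sum x L"
  unfolding coord_sum_def using assms
  by (intro sum.mono_neutral_right) (auto intro: inner_eq_0_if_in_span)

lemma coord_sum_diff_scaleR: "coord_sum (x - c *\<^sub>R y) L = coord_sum x L - c * coord_sum y L"
  unfolding coord_sum_def by (simp add: inner_diff_left sum_subtractf sum_distrib_left)

lemma coord_sum_e: "k \<le> L \<Longrightarrow> coord_sum (e k) L = 1"
  unfolding coord_sum_def by simp

text \<open>Coordinate \<open>p\<close> is the next one to be split and coordinate \<open>L\<close> the one that currently receives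
  mass; zero coordinates below \<open>L\<close> have been deleted.\<close>
definition balanced :: "'a \<Rightarrow> nat \<Rightarrow> nat \<Rightarrow> bool" where
  "balanced x p L \<longleftrightarrow> p < L \<and> x \<in> span (e ` {..L}) \<and> (\<forall>k. 0 \<le> x \<bullet> e k \<and> x \<bullet> e k \<le> x \<bullet> e p) \<and>
     (\<forall>k<L. x \<bullet> e k = 0 \<or> x \<bullet> e p \<le> 5 * (x \<bullet> e k)) \<and> 5 * (x \<bullet> e L) \<le> x \<bullet> e p"

lemma balancedD:
  assumes "balanced x p L"
  shows "p < L" "x \<in> span (e ` {..L})" "0 \<le> x \<bullet> e k" "x \<bullet> e k \<le> x \<bullet> e p"
    "k < L \<Longrightarrow> x \<bullet> e k = 0 \<or> x \<bullet> e p \<le> 5 * (x \<bullet> e k)" "5 * (x \<bullet> e L) \<le> x \<bullet> e p"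
  using assms unfolding balanced_def by auto

lemma balanced_rebalance:
  assumes span: "x \<in> span (e ` {..L})" and coord: "\<And>k. 0 \<le> x \<bullet> e k" "\<And>k. x \<bullet> e k \<le> M"
    and large: "\<And>k. k < L \<Longrightarrow> x \<bullet> e k = 0 \<or> M \<le> 5 * (x \<bullet> e k)"
  obtains p' L' where "L \<le> L'" "balanced x p' L'"
proof -
  obtain p where p: "p \<le> L" "Max ((\<lambda>k. x \<bullet> e k) ` {..L}) = x \<bullet> e p"
    using obtains_MAX[of "{..L}" "\<lambda>k. x \<bullet> e k"] by auto
  have le_p: "x \<bullet> e k \<le> x \<bullet> e p" for k
  proof (cases "k \<le> L")
    case True
    then show ?thesis using Max_ge[of "(\<lambda>k. x \<bullet> e k) ` {..L}" "x \<bullet> e k"] p(2) by simp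
  next
    case False
    then show ?thesis using inner_eq_0_if_in_span[OF span, of k] coord(1)[of p] by simp
  qed
  have large_p: "x \<bullet> e k = 0 \<or> x \<bullet> e p \<le> 5 * (x \<bullet> e k)" if "k < L" for k
    using large[OF that] coord(2)[of p] by linarith
  show thesis
  proof (cases "p = L \<or> x \<bullet> e p < 5 * (x \<bullet> e L)")
    case True
    have "x \<in> span (e ` {..Suc L})" using span by (rule subsetD[OF span_mono, rotated]) auto
    moreover have "x \<bullet> e (Suc L) = 0" using inner_eq_0_if_in_span[OF span] by simp
    moreover have "x \<bullet> e p \<le> 5 * (x \<bullet> e L)" using True coord(1)[of L] by auto
    ultimately have "balanced x p (Suc L)"
      unfolding balanced_def using p(1) coord(1) le_p large_p by (auto simp: less_Suc_eq)
    then show thesis using that[of "Suc L"] by simp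
  next
    case False
    then have "balanced x p L" unfolding balanced_def using p(1) span coord(1) le_p large_p by auto
    then show thesis using that[of L] by simp
  qed
qed

lemma balanced_power2_norm_le:
  assumes "balanced x p L"
  shows "(norm x)\<^sup>2 \<le> (x \<bullet> e p) * coord_sum x L"
proof -
  have "(norm x)\<^sup>2 = (\<Sum>k\<le>L. (x \<bullet> e k)\<^sup>2)"
    by (rule parseval[OF orthonormal_on finite_atMost balancedD(2)[OF assms]])
  also have "\<dots> \<le> (x \<bullet> e p) * coord_sum x L"
    unfolding coord_sum_def sum_distrib_left power2_eq_square
    by (intro sum_mono mult_right_mono balancedD(3,4)[OF assms])
  finally show ?thesis .
qed

lemma balanced_max_coord_sum_le:
  assumes "balanced x p L"
  shows "(x \<bullet> e p) * coord_sum x L \<le> 6 * (norm x)\<^sup>2"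
proof -
  have nonneg: "0 \<le> x \<bullet> e k" for k by (rule balancedD(3)[OF assms])
  have "(x \<bullet> e p) * (x \<bullet> e k) \<le> 5 * (x \<bullet> e k)\<^sup>2" if "k < L" for k
    using balancedD(5)[OF assms that]
      mult_right_mono[of "x \<bullet> e p" "5 * (x \<bullet> e k)", OF _ nonneg[of k]]
    by (auto simp: power2_eq_square)
  then have "(\<Sum>k<L. (x \<bullet> e p) * (x \<bullet> e k)) \<le> (\<Sum>k<L. 5 * (x \<bullet> e k)\<^sup>2)" by (intro sum_mono) simp
  also have "\<dots> = 5 * (\<Sum>k<L. (x \<bullet> e k)\<^sup>2)" by (simp add: sum_distrib_left)
  also have "\<dots> \<le> 5 * (norm x)\<^sup>2" using bessel_inequality[OF orthonormal_on finite_lessThan] by simp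
  finally have below: "(\<Sum>k<L. (x \<bullet> e p) * (x \<bullet> e k)) \<le> 5 * (norm x)\<^sup>2" .
  have "(x \<bullet> e p) * (x \<bullet> e L) \<le> (x \<bullet> e p)\<^sup>2"
    unfolding power2_eq_square by (intro mult_left_mono balancedD(4)[OF assms] nonneg)
  also have "\<dots> \<le> (norm x)\<^sup>2" using bessel_inequality[OF orthonormal_on, of "{p}"] by simp
  finally have "(x \<bullet> e p) * (x \<bullet> e L) \<le> (norm x)\<^sup>2" .
  with below show ?thesis
    by (simp add: coord_sum_def distrib_left sum_distrib_left flip: lessThan_Suc_atMost)
qed

text \<open>The first case deletes the largest coordinate, which is admissible for every weakness
  parameter; in the second one the opposite signs move mass from \<open>p\<close> to \<open>L\<close>, which increases the
  coordinate sum.\<close>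
definition step_direction :: "real \<Rightarrow> 'a \<Rightarrow> nat \<Rightarrow> nat \<Rightarrow> 'a" where
  "step_direction b x p L =
     (if x \<bullet> e p < 8 * b then e p else ((x \<bullet> e L + 2 * b) / (x \<bullet> e p)) *\<^sub>R e p - e L)"

abbreviation step_hyperplane :: "real \<Rightarrow> 'a \<Rightarrow> nat \<Rightarrow> nat \<Rightarrow> 'a set" where
  "step_hyperplane b x p L \<equiv> {y. step_direction b x p L \<bullet> y = 0}"

definition next_point :: "real \<Rightarrow> 'a \<Rightarrow> nat \<Rightarrow> nat \<Rightarrow> 'a" where
  "next_point b x p L = metric_proj (step_hyperplane b x p L) x"

lemma step_direction_cases:
  assumes "balanced x p L" "0 < b"
  obtains (delete) "x \<bullet> e p < 8 * b" "step_direction b x p L = e p"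
  | (split) \<tau> where "8 * b \<le> x \<bullet> e p" "step_direction b x p L = \<tau> *\<^sub>R e p - e L"
      "0 \<le> \<tau>" "\<tau> \<le> 1/2" "\<tau> * (x \<bullet> e p) = x \<bullet> e L + 2 * b"
proof (cases "x \<bullet> e p < 8 * b")
  case True
  then show thesis using delete by (simp add: step_direction_def)
next
  case False
  define \<tau> where "\<tau> = (x \<bullet> e L + 2 * b) / (x \<bullet> e p)"
  have "0 < x \<bullet> e p" using False \<open>0 < b\<close> by linarith
  then have \<tau>: "\<tau> * (x \<bullet> e p) = x \<bullet> e L + 2 * b" "0 \<le> \<tau>"
    unfolding \<tau>_def using balancedD(3)[OF assms(1)] \<open>0 < b\<close> by simp_all
  have "x \<bullet> e L + 2 * b \<le> 1/2 * (x \<bullet> e p)"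
    using balancedD(6)[OF assms(1)] balancedD(3)[OF assms(1), of p] False by linarith
  then have "\<tau> \<le> 1/2" unfolding \<tau>_def using \<open>0 < x \<bullet> e p\<close> by (simp only: pos_divide_le_eq)
  then show thesis using split[of \<tau>] False \<tau> by (simp add: step_direction_def \<tau>_def)
qed

lemma inner_split_direction: "(\<tau> *\<^sub>R e p - e L) \<bullet> x = \<tau> * (x \<bullet> e p) - x \<bullet> e L"
  unfolding inner_diff_left inner_scaleR_left by (simp add: inner_commute)

lemma inner_split_direction_self:
  "p \<noteq> L \<Longrightarrow> (\<tau> *\<^sub>R e p - e L) \<bullet> (\<tau> *\<^sub>R e p - e L) = 1 + \<tau>\<^sup>2"
  by (simp add: inner_diff_left inner_diff_right power2_eq_square)

lemma split_direction_nonzero: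
  assumes "p \<noteq> L"
  shows "\<tau> *\<^sub>R e p - e L \<noteq> 0"
proof -
  have "0 < (\<tau> *\<^sub>R e p - e L) \<bullet> (\<tau> *\<^sub>R e p - e L)"
    unfolding inner_split_direction_self[OF assms] by (simp add: add_pos_nonneg)
  then show ?thesis by simp
qed

lemma infdist_e_hyperplane: "infdist x {y. e p \<bullet> y = 0} = \<bar>x \<bullet> e p\<bar>"
  by (subst infdist_hyperplane) (simp_all add: inner_commute)

lemma infdist_split_hyperplane:
  assumes "p \<noteq> L"
  shows "infdist x {y. (\<tau> *\<^sub>R e p - e L) \<bullet> y = 0} = \<bar>\<tau> * (x \<bullet> e p) - x \<bullet> e L\<bar> / sqrt (1 + \<tau>\<^sup>2)"
  unfolding infdist_hyperplane[OF split_direction_nonzero[OF assms]] norm_eq_sqrt_inner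
    inner_split_direction_self[OF assms]
  by (simp only: inner_split_direction diff_zero)

lemma next_point_delete:
  assumes "step_direction b x p L = e p"
  shows "next_point b x p L = x - (x \<bullet> e p) *\<^sub>R e p"
  unfolding next_point_def assms by (subst metric_proj_hyperplane) (auto simp: inner_commute)

lemma next_point_split:
  assumes "step_direction b x p L = \<tau> *\<^sub>R e p - e L" "p \<noteq> L" "\<tau> * (x \<bullet> e p) = x \<bullet> e L + 2 * b"
  shows "next_point b x p L = x - (2 * b / (1 + \<tau>\<^sup>2)) *\<^sub>R (\<tau> *\<^sub>R e p - e L)"
proof -
  have "(\<tau> *\<^sub>R e p - e L) \<bullet> x = 2 * b" unfolding inner_split_direction using assms(3) by simp
  then show ?thesis
    unfolding next_point_def assms(1)
      metric_proj_hyperplane[OF split_direction_nonzero[OF assms(2)]]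
      inner_split_direction_self[OF assms(2)] by simp
qed

lemma split_coefficient_bounds:
  fixes b \<tau> :: real
  assumes "0 < b" "0 \<le> \<tau>" "\<tau> \<le> 1/2"
  shows "8/5 * b \<le> 2 * b / (1 + \<tau>\<^sup>2)" "2 * b / (1 + \<tau>\<^sup>2) \<le> 2 * b"
proof -
  have "\<tau>\<^sup>2 \<le> (1/2)\<^sup>2" using assms by (intro power_mono) auto
  then have "1 + \<tau>\<^sup>2 \<le> 5/4" by (simp add: power2_eq_square)
  then have "8/5 * b * (1 + \<tau>\<^sup>2) \<le> 8/5 * b * (5/4)" using \<open>0 < b\<close> by (intro mult_left_mono) auto
  then show "8/5 * b \<le> 2 * b / (1 + \<tau>\<^sup>2)" by (simp add: pos_le_divide_eq add_pos_nonneg)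
  show "2 * b / (1 + \<tau>\<^sup>2) \<le> 2 * b"
    using \<open>0 < b\<close> by (simp add: pos_divide_le_eq add_pos_nonneg algebra_simps)
qed

lemma step_direction_nonzero:
  assumes "balanced x p L" "0 < b"
  shows "step_direction b x p L \<noteq> 0"
  using assms
proof (cases rule: step_direction_cases)
  case delete
  then show ?thesis by simp
next
  case (split \<tau>)
  then show ?thesis using split_direction_nonzero balancedD(1)[OF assms(1)] by auto
qed

lemma next_point_in_span:
  assumes "balanced x p L" "0 < b"
  shows "next_point b x p L \<in> span (e ` {..L})"
proof -
  have "e k \<in> span (e ` {..L})" if "k \<le> L" for k using that by (intro span_base) auto
  then have "step_direction b x p L \<in> span (e ` {..L})"
    using balancedD(1)[OF assms(1)] unfolding step_direction_def
    by (auto intro!: span_diff span_scale)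
  then show ?thesis
    unfolding next_point_def metric_proj_hyperplane[OF step_direction_nonzero[OF assms]]
    by (intro span_diff balancedD(2)[OF assms(1)] span_scale)
qed

lemma next_point_coordinates:
  assumes bal: "balanced x p L" and "0 < b"
  shows "0 \<le> next_point b x p L \<bullet> e k" (is ?nonneg)
    and "next_point b x p L \<bullet> e k \<le> x \<bullet> e p" (is ?le_max)
    and "k < L \<Longrightarrow> next_point b x p L \<bullet> e k = 0 \<or> x \<bullet> e p \<le> 5 * (next_point b x p L \<bullet> e k)"
      (is "_ \<Longrightarrow> ?zero_or_large")
proof -
  note coord = balancedD(3-6)[OF bal] and pL = balancedD(1)[OF bal]
  have "?nonneg \<and> ?le_max \<and> (k < L \<longrightarrow> ?zero_or_large)"
    using assms
  proof (cases rule: step_direction_cases)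
    case delete
    have "next_point b x p L \<bullet> e k = (if k = p then 0 else x \<bullet> e k)"
      unfolding next_point_delete[OF delete(2)] by (simp add: inner_diff_left)
    then show ?thesis using coord by simp
  next
    case (split \<tau>)
    define s where "s = 2 * b / (1 + \<tau>\<^sup>2)"
    define r where "r = s * \<tau>"
    have s: "8/5 * b \<le> s" "s \<le> 2 * b"
      unfolding s_def using split_coefficient_bounds[OF \<open>0 < b\<close> split(3,4)] by auto
    have "r \<le> 2 * b * (1/2)" unfolding r_def using s split \<open>0 < b\<close> by (intro mult_mono) auto
    then have r: "0 \<le> r" "r \<le> b" unfolding r_def using s split \<open>0 < b\<close> by auto
    have "next_point b x p L = x - s *\<^sub>R (\<tau> *\<^sub>R e p - e L)"
      unfolding s_def using split pL by (intro next_point_split) auto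
    then have "next_point b x p L \<bullet> e k
        = (if k = p then x \<bullet> e p - r else if k = L then x \<bullet> e L + s else x \<bullet> e k)"
      unfolding r_def using pL by (simp add: inner_diff_left right_diff_distrib)
    moreover have "x \<bullet> e L + s \<le> x \<bullet> e p" using s coord(4) split(1) \<open>0 < b\<close> by linarith
    moreover have "x \<bullet> e p \<le> 5 * (x \<bullet> e p - r)"
      unfolding right_diff_distrib using r split(1) \<open>0 < b\<close> by linarith
    ultimately show ?thesis using coord s r \<open>0 < b\<close> by (auto simp: add_nonneg_nonneg)
  qed
  then show ?nonneg ?le_max "k < L \<Longrightarrow> ?zero_or_large" by auto
qed

lemma next_point_balanced:
  assumes "balanced x p L" "0 < b"
  obtains p' L' where "L \<le> L'" "balanced (next_point b x p L) p' L'"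
  using balanced_rebalance[OF next_point_in_span next_point_coordinates] by (metis assms)

lemma power2_norm_next_point:
  assumes "balanced x p L" "0 < b"
  shows "(norm (next_point b x p L))\<^sup>2
    = (norm x)\<^sup>2 - (infdist x (step_hyperplane b x p L))\<^sup>2"
  unfolding next_point_def
  by (rule power2_norm_metric_proj_hyperplane[OF step_direction_nonzero[OF assms]])

lemma infdist_step_hyperplane_bounds:
  assumes "balanced x p L" "0 < b"
  shows "min b (x \<bullet> e p) \<le> infdist x (step_hyperplane b x p L)" (is ?lower)
    and "infdist x (step_hyperplane b x p L) \<le> 8 * b" (is ?upper)
proof -
  have "?lower \<and> ?upper"
    using assms
  proof (cases rule: step_direction_cases)
    case delete
    then show ?thesis using balancedD(3)[OF assms(1), of p] by (simp add: infdist_e_hyperplane)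
  next
    case (split \<tau>)
    have "p \<noteq> L" using balancedD(1)[OF assms(1)] by simp
    then have dist: "infdist x (step_hyperplane b x p L) = 2 * b / sqrt (1 + \<tau>\<^sup>2)"
      unfolding split(2) using split(5) \<open>0 < b\<close> by (simp add: infdist_split_hyperplane)
    define s where "s = sqrt (1 + \<tau>\<^sup>2)"
    have "\<tau>\<^sup>2 \<le> 1" using split(3,4) by (simp add: power_le_one)
    then have s: "1 \<le> s" "s \<le> 2" unfolding s_def by (auto intro: real_le_lsqrt)
    then have "b * s \<le> b * 2" using \<open>0 < b\<close> by (intro mult_left_mono) auto
    then have "b \<le> 2 * b / s" using s by (simp add: pos_le_divide_eq)
    moreover have "2 * b / s \<le> 8 * b" using s \<open>0 < b\<close> by (simp add: pos_divide_le_eq)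
    ultimately show ?thesis unfolding dist s_def[symmetric] by simp
  qed
  then show ?lower ?upper by auto
qed

lemma infdist_step_hyperplane_le:
  assumes "balanced x p L" "0 < b"
  obtains \<tau> \<upsilon> where "0 \<le> \<tau>" "\<tau> \<le> 1" "0 \<le> \<upsilon>" "\<upsilon> \<le> 1"
    "infdist y (step_hyperplane b x p L) \<le> \<bar>\<tau> * (y \<bullet> e p) - \<upsilon> * (y \<bullet> e L)\<bar>"
  using assms
proof (cases rule: step_direction_cases)
  case delete
  then show thesis using that[of 1 0] by (simp add: infdist_e_hyperplane)
next
  case (split \<tau>)
  have "p \<noteq> L" using balancedD(1)[OF assms(1)] by simp
  have "infdist y (step_hyperplane b x p L) \<le> \<bar>\<tau> * (y \<bullet> e p) - y \<bullet> e L\<bar> / 1"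
    unfolding split(2) infdist_split_hyperplane[OF \<open>p \<noteq> L\<close>]
    by (intro divide_left_mono) (auto simp: add_pos_nonneg)
  then show thesis using that[of \<tau> 1] split(3,4) by simp
qed

lemma infdist_step_hyperplane_le_sum:
  assumes "balanced x p L" "0 < b"
  shows "infdist y (step_hyperplane b x p L) \<le> \<bar>y \<bullet> e p\<bar> + \<bar>y \<bullet> e L\<bar>"
proof -
  obtain \<tau> \<upsilon> where "0 \<le> \<tau>" "\<tau> \<le> 1" "0 \<le> \<upsilon>" "\<upsilon> \<le> 1"
    and "infdist y (step_hyperplane b x p L) \<le> \<bar>\<tau> * (y \<bullet> e p) - \<upsilon> * (y \<bullet> e L)\<bar>"
    using infdist_step_hyperplane_le[OF assms] .
  moreover from this have "\<bar>\<tau> * (y \<bullet> e p)\<bar> \<le> \<bar>y \<bullet> e p\<bar>" "\<bar>\<upsilon> * (y \<bullet> e L)\<bar> \<le> \<bar>y \<bullet> e L\<bar>"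
    by (simp_all add: abs_mult mult_left_le_one_le)
  ultimately show ?thesis by linarith
qed

lemma infdist_step_hyperplane_le_max:
  assumes "balanced x p L" "0 < b" and y: "\<And>k. 0 \<le> y \<bullet> e k" "\<And>k. y \<bullet> e k \<le> M"
  shows "infdist y (step_hyperplane b x p L) \<le> M"
proof -
  obtain \<tau> \<upsilon> where "0 \<le> \<tau>" "\<tau> \<le> 1" "0 \<le> \<upsilon>" "\<upsilon> \<le> 1"
    and "infdist y (step_hyperplane b x p L) \<le> \<bar>\<tau> * (y \<bullet> e p) - \<upsilon> * (y \<bullet> e L)\<bar>"
    using infdist_step_hyperplane_le[OF assms(1,2)] .
  moreover from this have "0 \<le> \<tau> * (y \<bullet> e p)" "\<tau> * (y \<bullet> e p) \<le> y \<bullet> e p"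
    "0 \<le> \<upsilon> * (y \<bullet> e L)" "\<upsilon> * (y \<bullet> e L) \<le> y \<bullet> e L"
    using y(1) by (simp_all add: mult_left_le_one_le)
  ultimately show ?thesis using y(2)[of p] y(2)[of L] by linarith
qed

lemma coord_sum_split_direction:
  assumes "p \<le> L"
  shows "coord_sum (\<tau> *\<^sub>R e p - e L) L = \<tau> - 1"
  using assms by (simp add: coord_sum_def inner_diff_left sum_subtractf flip: sum_distrib_left)

lemma coord_sum_next_point_ge:
  assumes "balanced x p L" "0 < b" "1/2 \<le> (norm x)\<^sup>2"
  shows "(1 - 136 * b\<^sup>2) * coord_sum x L + b / 2 \<le> coord_sum (next_point b x p L) L"
  using assms(1,2)
proof (cases rule: step_direction_cases)
  case delete
  \<comment> \<open>The loss \<open>x \<bullet> e p < 8 * b\<close> is small relative to the coordinate sum: the latter is at least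
    \<open>1 / (16 * b)\<close>.\<close>
  have "1/2 \<le> (x \<bullet> e p) * coord_sum x L"
    using assms(3) balanced_power2_norm_le[OF assms(1)] by linarith
  also have "\<dots> \<le> 8 * b * coord_sum x L"
    using delete(1) balancedD(3)[OF assms(1)] unfolding coord_sum_def
    by (intro mult_right_mono sum_nonneg) auto
  finally have "17 * b * (1/2) \<le> 17 * b * (8 * b * coord_sum x L)"
    using \<open>0 < b\<close> by (intro mult_left_mono) auto
  then have "8 * b + b / 2 \<le> 136 * b\<^sup>2 * coord_sum x L" by (simp add: power2_eq_square mult_ac)
  moreover have "coord_sum (next_point b x p L) L = coord_sum x L - x \<bullet> e p"
    using balancedD(1)[OF assms(1)]
    by (simp add: next_point_delete[OF delete(2)] coord_sum_diff_scaleR coord_sum_e)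
  ultimately show ?thesis unfolding left_diff_distrib using delete(1) by linarith
next
  case (split \<tau>)
  define s where "s = 2 * b / (1 + \<tau>\<^sup>2)"
  have pL: "p < L" by (rule balancedD(1)[OF assms(1)])
  have "next_point b x p L = x - s *\<^sub>R (\<tau> *\<^sub>R e p - e L)"
    unfolding s_def using split pL by (intro next_point_split) auto
  then have "coord_sum (next_point b x p L) L = coord_sum x L - s * (\<tau> - 1)"
    using pL by (simp add: coord_sum_diff_scaleR coord_sum_split_direction)
  moreover have "8/5 * b * (1/2) \<le> s * (1 - \<tau>)"
    using split_coefficient_bounds(1)[OF assms(2) split(3,4)] split(4) \<open>0 < b\<close>
    unfolding s_def by (intro mult_mono) auto
  moreover have "0 \<le> 136 * b\<^sup>2 * coord_sum x L"
    using balancedD(3)[OF assms(1)] unfolding coord_sum_def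
    by (intro mult_nonneg_nonneg sum_nonneg) auto
  ultimately show ?thesis unfolding left_diff_distrib right_diff_distrib using \<open>0 < b\<close> by linarith
qed

section \<open>A sequence of remote projections without a limit in the intersection\<close>

lemma balanced_constant_block:
  assumes "0 < q"
  obtains x where "balanced x 0 (q\<^sup>2)" "norm x = 1" "coord_sum x (q\<^sup>2) = real q"
proof -
  define x where "x = (\<Sum>k<q\<^sup>2. (1 / real q) *\<^sub>R e k)"
  have "0 < q\<^sup>2" using assms by simp
  have coord: "x \<bullet> e k = (if k < q\<^sup>2 then 1 / real q else 0)" for k
  proof -
    have "x \<bullet> e k = (\<Sum>i<q\<^sup>2. if i = k then 1 / real q else 0)"
      unfolding x_def inner_sum_left by (intro sum.cong) auto
    then show ?thesis by simp
  qed
  have "x \<in> span (e ` {..q\<^sup>2})" unfolding x_def by (intro span_sum span_scale span_base) auto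
  then have "balanced x 0 (q\<^sup>2)"
    using \<open>0 < q\<^sup>2\<close> unfolding balanced_def by (simp add: coord divide_right_mono)
  moreover have "(norm x)\<^sup>2 = 1"
    unfolding x_def power2_norm_orthonormal_sum[OF orthonormal_on finite_lessThan]
    using assms by (simp add: power_divide)
  then have "norm x = 1" using norm_ge_zero[of x] by (auto simp: power2_eq_1_iff)
  moreover have "coord_sum x (q\<^sup>2) = (\<Sum>k<q\<^sup>2. 1 / real q)"
    unfolding coord_sum_def by (intro sum.mono_neutral_cong_right) (auto simp: coord)
  then have "coord_sum x (q\<^sup>2) = real q" using assms by (simp add: power2_eq_square)
  ultimately show thesis by (rule that)
qed

lemma balanced_sequence_exists:
  assumes "\<And>n. 0 < b n" "balanced x0 p0 L0"
  obtains x :: "nat \<Rightarrow> 'a" and p L :: "nat \<Rightarrow> nat" where "x 0 = x0" "L 0 = L0"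
    "\<And>n. balanced (x n) (p n) (L n)" "\<And>n. L n \<le> L (Suc n)"
    "\<And>n. x (Suc n) = next_point (b n) (x n) (p n) (L n)"
proof -
  let ?P = "\<lambda>(n::nat) (x, p, L). balanced x p L \<and> (n = 0 \<longrightarrow> x = x0 \<and> L = L0)"
  let ?Q = "\<lambda>n (x, p, L) (x', p'::nat, L'). L \<le> L' \<and> x' = next_point (b n) x p L"
  have "\<exists>f. \<forall>n. ?P n (f n) \<and> ?Q n (f n) (f (Suc n))"
  proof (rule dependent_nat_choice)
    show "\<exists>s. ?P 0 s" using assms(2) by auto
    fix s n assume "?P n s"
    then obtain x p L where s: "s = (x, p, L)" "balanced x p L" by (cases s) auto
    obtain p' L' where "L \<le> L'" "balanced (next_point (b n) x p L) p' L'"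
      using next_point_balanced[OF s(2) assms(1)] .
    then show "\<exists>s'. ?P (Suc n) s' \<and> ?Q n s s'"
      by (intro exI[of _ "(next_point (b n) x p L, p', L')"]) (simp add: s(1))
  qed
  then obtain f where f: "\<forall>n. ?P n (f n) \<and> ?Q n (f n) (f (Suc n))" ..
  show thesis
    by (rule that[of "\<lambda>n. fst (f n)" "\<lambda>n. snd (snd (f n))" "\<lambda>n. fst (snd (f n))"])
      (use f[rule_format, of 0] f in \<open>simp_all add: case_prod_beta\<close>)
qed

end

text \<open>With \<open>1/272\<close> the accumulated losses, at most \<open>64 * b\<^sup>2\<close> per step for the squared norm and
  relatively \<open>136 * b\<^sup>2\<close> for the coordinate sum, are at most \<open>1/2\<close>.\<close>
locale splitting_sequence = orthonormal_sequence e for e :: "nat \<Rightarrow> 'a::real_inner" +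
  fixes b :: "nat \<Rightarrow> real" and q :: real and x :: "nat \<Rightarrow> 'a" and p L :: "nat \<Rightarrow> nat"
  assumes b_pos: "\<And>n. 0 < b n" and b_small: "\<And>n. (\<Sum>k<n. (b k)\<^sup>2) \<le> 1/272"
    and q_pos: "0 < q"
    and norm_start: "norm (x 0) = 1" and coord_sum_start: "coord_sum (x 0) (L 0) = q"
    and balanced: "\<And>n. balanced (x n) (p n) (L n)" and L_mono: "\<And>n. L n \<le> L (Suc n)"
    and x_Suc: "\<And>n. x (Suc n) = next_point (b n) (x n) (p n) (L n)"
begin

abbreviation max_coord :: "nat \<Rightarrow> real" where
  "max_coord n \<equiv> x n \<bullet> e (p n)"

abbreviation hyperplane :: "nat \<Rightarrow> 'a set" where
  "hyperplane n \<equiv> step_hyperplane (b n) (x n) (p n) (L n)"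

lemma b_nonneg: "0 \<le> b n"
  using b_pos[of n] by simp

lemma coord_nonneg: "0 \<le> x n \<bullet> e k" and coord_le_max_coord: "x n \<bullet> e k \<le> max_coord n"
  using balancedD(3,4)[OF balanced] by auto

lemma power2_norm_Suc: "(norm (x (Suc n)))\<^sup>2 = (norm (x n))\<^sup>2 - (infdist (x n) (hyperplane n))\<^sup>2"
  unfolding x_Suc by (rule power2_norm_next_point[OF balanced b_pos])

lemma norm_le_1: "norm (x n) \<le> 1"
proof -
  have "(norm (x n))\<^sup>2 \<le> 1"
  proof (induction n)
    case (Suc n)
    then show ?case unfolding power2_norm_Suc by (smt (verit) zero_le_power2)
  qed (simp add: norm_start)
  then show ?thesis using abs_square_le_1[of "norm (x n)"] by simp
qed

lemma power2_norm_ge: "1/2 \<le> (norm (x n))\<^sup>2"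
proof -
  have "1 - 64 * (\<Sum>k<n. (b k)\<^sup>2) \<le> (norm (x n))\<^sup>2"
  proof (induction n)
    case (Suc n)
    have "(infdist (x n) (hyperplane n))\<^sup>2 \<le> (8 * b n)\<^sup>2"
      by (intro power_mono infdist_nonneg infdist_step_hyperplane_bounds(2) balanced b_pos)
    then show ?case using Suc unfolding power2_norm_Suc by (simp add: power_mult_distrib)
  qed (simp add: norm_start)
  then show ?thesis using b_small[of n] by linarith
qed

lemma coord_sum_Suc:
  "(1 - 136 * (b n)\<^sup>2) * coord_sum (x n) (L n) + b n / 2 \<le> coord_sum (x (Suc n)) (L (Suc n))"
proof -
  have "coord_sum (x (Suc n)) (L (Suc n)) = coord_sum (x (Suc n)) (L n)"
    unfolding x_Suc by (rule coord_sum_extend[OF next_point_in_span[OF balanced b_pos] L_mono])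
  then show ?thesis
    using coord_sum_next_point_ge[OF balanced b_pos power2_norm_ge, of n n] by (simp add: x_Suc)
qed

lemma coord_sum_ge: "q + (\<Sum>k<n. b k) \<le> 4 * coord_sum (x n) (L n)"
proof -
  have small: "(\<Sum>k<m. 136 * (b k)\<^sup>2) \<le> 1/2" for m
    unfolding sum_distrib_left[symmetric] using b_small[of m] by simp
  have "0 \<le> (\<Sum>k<n. b k)" by (intro sum_nonneg b_nonneg)
  then have "1/2 * (q + (\<Sum>k<n. b k) / 2)
      \<le> (1 - (\<Sum>k<n. 136 * (b k)\<^sup>2)) * (coord_sum (x 0) (L 0) + (\<Sum>k<n. b k / 2))"
    unfolding coord_sum_start sum_divide_distrib[symmetric]
    using small[of n] q_pos by (intro mult_right_mono) auto
  also have "\<dots> \<le> coord_sum (x n) (L n)"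
  proof (rule discrete_gronwall_lower_bound)
    show "(\<Sum>k<m. 136 * (b k)\<^sup>2) \<le> 1" for m using small[of m] by linarith
  qed (use coord_sum_Suc b_nonneg coord_sum_start q_pos in auto)
  finally show ?thesis using q_pos by simp
qed

lemma max_coord_le: "max_coord n * (q + (\<Sum>k<n. b k)) \<le> 24"
proof -
  have "max_coord n * (q + (\<Sum>k<n. b k)) \<le> max_coord n * (4 * coord_sum (x n) (L n))"
    by (intro mult_left_mono coord_sum_ge coord_nonneg)
  also have "\<dots> \<le> 4 * (6 * (norm (x n))\<^sup>2)"
    using balanced_max_coord_sum_le[OF balanced, of n] by simp
  also have "\<dots> \<le> 24" using norm_le_1[of n] by (simp add: power_le_one)
  finally show ?thesis .
qed

lemma L_at_top:
  assumes "filterlim (\<lambda>n. \<Sum>k<n. b k) at_top sequentially"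
  shows "filterlim L at_top sequentially"
proof -
  have "x n \<bullet> e k \<le> 1" for n k
    using Cauchy_Schwarz_ineq2[of "x n" "e k"] norm_le_1[of n] by simp
  then have "coord_sum (x n) (L n) \<le> (\<Sum>k\<le>L n. 1)" for n unfolding coord_sum_def by (intro sum_mono)
  then have coord_sum_le: "coord_sum (x n) (L n) \<le> 1 + real (L n)" for n by simp
  have L_ge: "-1 + (1/4) * (\<Sum>k<n. b k) \<le> real (L n)" for n
    using coord_sum_le[of n] coord_sum_ge[of n] q_pos by linarith
  have "filterlim (\<lambda>n. -1 + (1/4) * (\<Sum>k<n. b k)) at_top sequentially"
    by (intro filterlim_tendsto_add_at_top[OF tendsto_const]
        filterlim_tendsto_pos_mult_at_top[OF tendsto_const _ assms]) simp
  then have "filterlim (\<lambda>n. real (L n)) at_top sequentially"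
    by (rule filterlim_at_top_mono) (use L_ge in simp)
  then show ?thesis unfolding filterlim_sequentially_iff_filterlim_real .
qed

text \<open>With the hyperplanes orthogonal to the \<open>e i\<close> in the family, the supremum of the distances is
  attained at every point and the intersection meets the closed span of \<open>e\<close> only in \<open>0\<close>.\<close>
definition family :: "nat \<Rightarrow> 'a set" where
  "family k = (if even k then {y. e (k div 2) \<bullet> y = 0} else hyperplane (k div 2))"

lemma family_even: "family (2 * i) = {y. e i \<bullet> y = 0}"
  and family_odd: "family (2 * n + 1) = hyperplane n"
  unfolding family_def by simp_all

lemma closed_family: "closed (family k)" and convex_family: "convex (family k)"
  unfolding family_def by (simp_all add: closed_hyperplane convex_hyperplane)

lemma unif_quasi_symmetric_family: "unif_quasi_symmetric_wrt UNIV family 0"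
  unfolding unif_quasi_symmetric_wrt_def unif_quasi_symmetric_def
  by (auto simp: family_def intro!: exI[of _ 1])

lemma infdist_family_even: "infdist y (family (2 * i)) = \<bar>y \<bullet> e i\<bar>"
  unfolding family_even by (rule infdist_e_hyperplane)

lemma infdist_family_odd_le: "infdist y (family (2 * n + 1)) \<le> \<bar>y \<bullet> e (p n)\<bar> + \<bar>y \<bullet> e (L n)\<bar>"
  unfolding family_odd by (rule infdist_step_hyperplane_le_sum[OF balanced b_pos])

lemma infdist_family_attains_max:
  assumes "filterlim L at_top sequentially"
  obtains k where "\<And>j. infdist y (family j) \<le> infdist y (family k)"
proof -
  have coord: "(\<lambda>i. \<bar>y \<bullet> e i\<bar>) \<longlonglongrightarrow> 0" by (rule tendsto_rabs_zero[OF inner_tendsto_zero])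
  have "\<forall>\<^sub>F i in sequentially. \<bar>y \<bullet> e i\<bar> \<le> \<bar>y \<bullet> e 0\<bar> + \<epsilon>" if "0 < \<epsilon>" for \<epsilon>
    using order_tendstoD(2)[OF coord that] by eventually_elim simp
  then obtain i0 where i0: "\<And>i. \<bar>y \<bullet> e i\<bar> \<le> \<bar>y \<bullet> e i0\<bar>"
    using attains_max_if_eventually_le[of "\<lambda>i. \<bar>y \<bullet> e i\<bar>" 0] by blast
  show thesis
  proof (rule attains_max_if_eventually_le)
    fix \<epsilon> :: real assume "0 < \<epsilon>"
    then obtain N where N: "\<And>n. N \<le> n \<Longrightarrow> \<bar>y \<bullet> e (L n)\<bar> < \<epsilon>"
      using order_tendstoD(2)[OF filterlim_compose[OF coord assms], of \<epsilon>]
      unfolding eventually_sequentially by blast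
    show "\<forall>\<^sub>F k in sequentially. infdist y (family k) \<le> infdist y (family (2 * i0)) + \<epsilon>"
    proof (rule eventually_sequentiallyI)
      fix k assume "2 * N + 1 \<le> k"
      show "infdist y (family k) \<le> infdist y (family (2 * i0)) + \<epsilon>"
      proof (cases "even k")
        case True
        then obtain i where "k = 2 * i" by blast
        then show ?thesis using i0[of i] \<open>0 < \<epsilon>\<close> by (simp add: infdist_family_even)
      next
        case False
        then obtain n where n: "k = 2 * n + 1" by (blast elim: oddE)
        then have "N \<le> n" using \<open>2 * N + 1 \<le> k\<close> by simp
        then show ?thesis
          unfolding n infdist_family_even
          using infdist_family_odd_le[of y n] i0[of "p n"] N[of n] by linarith
      qed
    qed
  qed (rule that)
qed

lemma SUP_infdist_family_le: "(SUP k. infdist (x n) (family k)) \<le> max_coord n"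
proof (rule cSUP_least)
  fix k
  show "infdist (x n) (family k) \<le> max_coord n"
  proof (cases "even k")
    case True
    then obtain i where "k = 2 * i" by blast
    then show ?thesis using coord_nonneg coord_le_max_coord by (simp add: infdist_family_even)
  next
    case False
    then obtain m where m: "k = 2 * m + 1" by (blast elim: oddE)
    show ?thesis
      unfolding m family_odd
      by (intro infdist_step_hyperplane_le_max balanced b_pos coord_nonneg coord_le_max_coord)
  qed
qed simp

lemma weakness_le_infdist:
  assumes "0 \<le> t" "t \<le> 1" "24 * t \<le> b n * (q + (\<Sum>k<n. b k))"
  shows "t * max_coord n \<le> infdist (x n) (hyperplane n)"
proof -
  have "0 < q + (\<Sum>k<n. b k)" using q_pos b_nonneg by (intro add_pos_nonneg sum_nonneg) auto
  moreover have "t * max_coord n * (q + (\<Sum>k<n. b k)) \<le> b n * (q + (\<Sum>k<n. b k))"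
    using mult_left_mono[OF max_coord_le \<open>0 \<le> t\<close>, of n] assms(3) by (simp add: mult_ac)
  ultimately have "t * max_coord n \<le> b n" by simp
  moreover have "t * max_coord n \<le> max_coord n"
    using assms coord_nonneg by (intro mult_left_le_one_le) auto
  ultimately show ?thesis
    using infdist_step_hyperplane_bounds(1)[OF balanced b_pos, of n n] by linarith
qed

lemma remote_projections_family:
  assumes "\<And>n. 0 \<le> t n" "\<And>n. t n \<le> 1" "\<And>n. 24 * t n \<le> b n * (q + (\<Sum>k<n. b k))"
    and "filterlim (\<lambda>n. \<Sum>k<n. b k) at_top sequentially"
  shows "remote_projections UNIV family t (x 0) x"
  unfolding remote_projections_def
proof (intro conjI allI impI)
  fix y
  obtain k where "\<And>j. infdist y (family j) \<le> infdist y (family k)"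
    using infdist_family_attains_max[OF L_at_top[OF assms(4)]] by metis
  then have "(SUP j. infdist y (family j)) = infdist y (family k)" by (intro cSup_eq_maximum) auto
  then show "\<exists>k\<in>UNIV. infdist y (family k) = (SUP j. infdist y (family j))" by auto
next
  fix n
  have "t n * (SUP k. infdist (x n) (family k)) \<le> t n * max_coord n"
    by (intro mult_left_mono SUP_infdist_family_le assms(1))
  also have "\<dots> \<le> infdist (x n) (family (2 * n + 1))"
    unfolding family_odd by (intro weakness_le_infdist assms)
  finally show "\<exists>k\<in>UNIV. t n * (SUP j. infdist (x n) (family j)) \<le> infdist (x n) (family k) \<and>
      x (Suc n) = metric_proj (family k) (x n)"
    using x_Suc[of n] family_odd[of n]
    by (intro bexI[of _ "2 * n + 1"]) (simp_all add: next_point_def)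
qed simp

lemma not_tendsto_in_family:
  assumes "\<And>k. z \<in> family k"
  shows "\<not> x \<longlonglongrightarrow> z"
proof
  assume lim: "x \<longlonglongrightarrow> z"
  have "z \<bullet> e i = 0" for i
    using assms[of "2 * i"] unfolding family_even by (simp add: inner_commute)
  then have "orthogonal z (x n)" for n
    by (intro orthogonal_to_span[OF balancedD(2)[OF balanced]]) (auto simp: orthogonal_def)
  then have "(\<lambda>n. z \<bullet> x n) = (\<lambda>n. 0)" by (simp add: orthogonal_def)
  moreover have "(\<lambda>n. z \<bullet> x n) \<longlonglongrightarrow> z \<bullet> z" by (intro tendsto_intros lim)
  ultimately have "z \<bullet> z = 0" by (simp add: LIMSEQ_const_iff)
  moreover have "1/2 \<le> (norm z)\<^sup>2"
    by (rule LIMSEQ_le_const[OF tendsto_power[OF tendsto_norm[OF lim]]])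
      (use power2_norm_ge in auto)
  ultimately show False by (simp add: power2_norm_eq_inner)
qed

end

section \<open>Convergence implies condition (T)\<close>

lemma (in orthonormal_sequence) splitting_sequence_exists:
  assumes "\<And>n. 0 < b n" "\<And>n. (\<Sum>k<n. (b k)\<^sup>2) \<le> 1/272" "0 < q"
  obtains x p L where "splitting_sequence e b (real q) x p L"
proof -
  obtain x0 where x0: "balanced x0 0 (q\<^sup>2)" "norm x0 = 1" "coord_sum x0 (q\<^sup>2) = real q"
    using balanced_constant_block[OF \<open>0 < q\<close>] .
  obtain x p L where "x 0 = x0" "L 0 = q\<^sup>2" "\<And>n. balanced (x n) (p n) (L n)"
    "\<And>n. L n \<le> L (Suc n)" "\<And>n. x (Suc n) = next_point (b n) (x n) (p n) (L n)"
    using balanced_sequence_exists[where b = b, OF assms(1) x0(1)] by blast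
  with assms x0 show thesis by (intro that[of x p L]) (unfold_locales, simp_all)
qed

theorem remote_projections_converge_imp_condition_T:
  assumes t: "\<And>n. 0 \<le> t n" "\<And>n. t n \<le> 1"
    and "infinite_dimensional TYPE('a::{real_inner,complete_space})"
    and converge: "remote_projections_converge t TYPE('a) TYPE(nat)"
  shows "condition_T t"
proof (rule ccontr)
  assume "\<not> condition_T t"
  then obtain b :: "nat \<Rightarrow> real" and r where b: "\<And>n. 0 < b n" "\<And>n. (\<Sum>k<n. (b k)\<^sup>2) \<le> 1/272"
    and diverges: "filterlim (\<lambda>n. \<Sum>k<n. b k) at_top sequentially"
    and t_le: "\<And>n. 24 * t n \<le> b n * (r + (\<Sum>k<n. b k))"
    using not_condition_T_obtain_weights[of t 24 "1/272"] t
    by (metis zero_less_divide_1_iff zero_less_numeral)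
  define q where "q = Suc (nat \<lceil>r\<rceil>)"
  have "r \<le> real q" unfolding q_def by linarith
  then have "b n * (r + (\<Sum>k<n. b k)) \<le> b n * (real q + (\<Sum>k<n. b k))" for n
    using b(1)[of n] by (intro mult_left_mono) auto
  then have t_le_q: "24 * t n \<le> b n * (real q + (\<Sum>k<n. b k))" for n
    using t_le by (rule order_trans[rotated])
  obtain e :: "nat \<Rightarrow> 'a" where "orthonormal_on UNIV e"
    using infinite_dimensional_orthonormal_sequence[OF assms(3)] .
  then interpret orthonormal_sequence e by unfold_locales
  obtain x p L where "splitting_sequence e b (real q) x p L"
    using splitting_sequence_exists[OF b] unfolding q_def by blast
  then interpret splitting_sequence e b "real q" x p L .
  have "\<exists>z\<in>(\<Inter>k\<in>UNIV. family k). x \<longlonglongrightarrow> z"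
    using converge[unfolded remote_projections_converge_def] closed_family convex_family
      unif_quasi_symmetric_family remote_projections_family[OF t t_le_q diverges]
      zero_neq_one[where 'a = nat]
    by blast
  then show False using not_tendsto_in_family by blast
qed

theorem theorem1:
  fixes t :: "nat \<Rightarrow> real"
  assumes "\<And>n. 0 \<le> t n \<and> t n \<le> 1"
  shows "(condition_T t \<longrightarrow> remote_projections_converge t TYPE('a::{real_inner,complete_space}) TYPE('i))
       \<and> (infinite_dimensional TYPE('a) \<longrightarrow>
            remote_projections_converge t TYPE('a) TYPE(nat) \<longrightarrow> condition_T t)"
proof (intro conjI impI)
  assume "condition_T t"
  with assms show "remote_projections_converge t TYPE('a) TYPE('i)"
    by (intro condition_T_imp_remote_projections_converge) simp_all
next
  assume "infinite_dimensional TYPE('a)" "remote_projections_converge t TYPE('a) TYPE(nat)"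
  with assms show "condition_T t"
    by (intro remote_projections_converge_imp_condition_T) simp_all
qed

end
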